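(* Let $\pi=\{3\}$, let $G = E \ltimes V$ be the group of order $3^3\cdot 7^2$ described in the context, let $\chi\in \mathrm{Irr}(G/V)$ (viewed as a character of $G$) with $\chi(1)=3$, and let $\varphi=\chi^0$. Then there is no pair $(U,\delta)$, with $U \le G$ and $\delta \in \mathrm{Irr}(U)$ a $\pi$-special character, such that the map $\gamma \mapsto (\delta\gamma)^G$ is a bijection from the set of linear $\pi'$-special characters $\gamma$ of $U$ onto the set of all lifts of $\varphi$ in $\mathrm{Irr}(G)$.
   Context: The group $G$: let $E$ be an extra-special group of order $3^3$ and exponent $3$, and let $V = V_1 \times V_2$ be elementary abelian of order $7^2$ with $|V_1| = |V_2| = 7$. Let $M_1 \ne M_2$ be maximal subgroups of $E$. Let $E$ act on $V$ by automorphisms so that $E$ acts on $V_1$ with kernel $M_1$ and on $V_2$ with kernel $M_2$. Let $G$ be the resulting semidirect product of $E$ acting on $V$. Characters of $G/V$ are viewed as characters of $G$ with $V$ in their kernel; $G/V\cong E$ has two irreducible characters of degree $3$. For a set of primes $\pi$, $G^0$ is the set of $\pi$-elements of $G$ and $\chi^0$ is the restriction of a character $\chi$ of $G$ to $G^0$. A character $\psi\in\mathrm{Irr}(G)$ is a lift of $\varphi$ if $\psi^0 = \varphi$. A character $\theta\in\mathrm{Irr}(H)$ is $\pi$-special if $\theta(1)$ is a $\pi$-number and, for every subnormal subgroup $S$ of $H$, every irreducible constituent of $\theta_S$ has determinantal order a $\pi$-number; $\pi'$-special is defined likewise with the complementary set of primes $\pi'$. *)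

theory Defs
  imports
    "HOL-Algebra.Algebra"
    "Jordan_Normal_Form.Determinant"
    "Jordan_Normal_Form.VS_Connect"
begin

section \<open>Finite groups\<close>

definition maximal_subgroup :: "'a set \<Rightarrow> ('a, 'b) monoid_scheme \<Rightarrow> bool" where
  "maximal_subgroup M G \<longleftrightarrow>
     subgroup M G \<and> M \<noteq> carrier G \<and>
     (\<forall>H. subgroup H G \<and> M \<subseteq> H \<longrightarrow> H = M \<or> H = carrier G)"

definition frattini :: "('a, 'b) monoid_scheme \<Rightarrow> 'a set" where
  "frattini G = carrier G \<inter> \<Inter>{M. maximal_subgroup M G}"

definition group_center :: "('a, 'b) monoid_scheme \<Rightarrow> 'a set" where
  "group_center G = {z \<in> carrier G. \<forall>g \<in> carrier G. z \<otimes>\<^bsub>G\<^esub> g = g \<otimes>\<^bsub>G\<^esub> z}"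

definition group_exponent :: "('a, 'b) monoid_scheme \<Rightarrow> nat" where
  "group_exponent G = (LEAST n. 0 < n \<and> (\<forall>x \<in> carrier G. x [^]\<^bsub>G\<^esub> n = \<one>\<^bsub>G\<^esub>))"

definition extraspecial :: "nat \<Rightarrow> ('a, 'b) monoid_scheme \<Rightarrow> bool" where
  "extraspecial p G \<longleftrightarrow>
     group G \<and> Factorial_Ring.prime p \<and> (\<exists>k. Coset.order G = p ^ k) \<and>
     group_center G = derived G (carrier G) \<and> group_center G = frattini G \<and>
     card (group_center G) = p"

definition elementary_abelian :: "nat \<Rightarrow> ('a, 'b) monoid_scheme \<Rightarrow> bool" where
  "elementary_abelian p G \<longleftrightarrow>
     comm_group G \<and> Factorial_Ring.prime p \<and> finite (carrier G) \<and>
     (\<forall>x \<in> carrier G. x [^]\<^bsub>G\<^esub> p = \<one>\<^bsub>G\<^esub>)"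

text \<open>The semidirect product of \<open>E\<close> acting on \<open>V\<close> on the left through \<open>\<alpha>\<close>;
  \<open>V\<close> is embedded as the pairs with second component \<open>\<one>\<close>.\<close>

definition semidirect_product ::
    "('v, 'c) monoid_scheme \<Rightarrow> ('e, 'd) monoid_scheme \<Rightarrow> ('e \<Rightarrow> 'v \<Rightarrow> 'v) \<Rightarrow> ('v \<times> 'e) monoid" where
  "semidirect_product V E \<alpha> =
     \<lparr>carrier = carrier V \<times> carrier E,
      monoid.mult = (\<lambda>(v, e) (w, f). (v \<otimes>\<^bsub>V\<^esub> \<alpha> e w, e \<otimes>\<^bsub>E\<^esub> f)),
      one = (\<one>\<^bsub>V\<^esub>, \<one>\<^bsub>E\<^esub>)\<rparr>"

inductive subnormal :: "('a, 'b) monoid_scheme \<Rightarrow> 'a set \<Rightarrow> bool" for G where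
  subnormal_carrier: "subnormal G (carrier G)"
| subnormal_step: "subnormal G T \<Longrightarrow> S \<lhd> G\<lparr>carrier := T\<rparr> \<Longrightarrow> subnormal G S"

definition pi_number :: "nat set \<Rightarrow> nat \<Rightarrow> bool" where
  "pi_number \<pi> n \<longleftrightarrow> 0 < n \<and> (\<forall>p. Factorial_Ring.prime p \<and> p dvd n \<longrightarrow> p \<in> \<pi>)"

definition pi_elements :: "nat set \<Rightarrow> ('a, 'b) monoid_scheme \<Rightarrow> 'a set" where
  "pi_elements \<pi> G = {g \<in> carrier G. pi_number \<pi> (group.ord G g)}"


section \<open>Complex representations and characters\<close>

definition representation ::
    "('a, 'b) monoid_scheme \<Rightarrow> nat \<Rightarrow> ('a \<Rightarrow> complex mat) \<Rightarrow> bool" where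
  "representation G n \<rho> \<longleftrightarrow>
     \<rho> \<in> carrier G \<rightarrow> carrier_mat n n \<and> \<rho> \<one>\<^bsub>G\<^esub> = 1\<^sub>m n \<and>
     (\<forall>x \<in> carrier G. \<forall>y \<in> carrier G. \<rho> (x \<otimes>\<^bsub>G\<^esub> y) = \<rho> x * \<rho> y)"

definition irreducible_representation ::
    "('a, 'b) monoid_scheme \<Rightarrow> nat \<Rightarrow> ('a \<Rightarrow> complex mat) \<Rightarrow> bool" where
  "irreducible_representation G n \<rho> \<longleftrightarrow>
     representation G n \<rho> \<and> 0 < n \<and>
     (\<forall>W. subspace class_ring W (module_vec TYPE(complex) n) \<and>
          (\<forall>g \<in> carrier G. \<forall>w \<in> W. \<rho> g *\<^sub>v w \<in> W)
        \<longrightarrow> W = {0\<^sub>v n} \<or> W = carrier_vec n)"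

text \<open>Characters are extensional functions (\<open>undefined\<close> outside the carrier), so that
  equality of functions is equality of characters on the group.\<close>

definition character_of ::
    "('a, 'b) monoid_scheme \<Rightarrow> nat \<Rightarrow> ('a \<Rightarrow> complex mat) \<Rightarrow> 'a \<Rightarrow> complex" where
  "character_of G n \<rho> = (\<lambda>g \<in> carrier G. \<Sum>i<n. \<rho> g $$ (i, i))"

definition Irr :: "('a, 'b) monoid_scheme \<Rightarrow> ('a \<Rightarrow> complex) set" where
  "Irr G = {character_of G n \<rho> | n \<rho>. irreducible_representation G n \<rho>}"

definition inner_char ::
    "('a, 'b) monoid_scheme \<Rightarrow> ('a \<Rightarrow> complex) \<Rightarrow> ('a \<Rightarrow> complex) \<Rightarrow> complex" where
  "inner_char G f h = (\<Sum>g \<in> carrier G. f g * cnj (h g)) / of_nat (Coset.order G)"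

definition irr_constituents ::
    "('a, 'b) monoid_scheme \<Rightarrow> ('a \<Rightarrow> complex) \<Rightarrow> ('a \<Rightarrow> complex) set" where
  "irr_constituents G \<theta> = {\<psi> \<in> Irr G. inner_char G \<theta> \<psi> \<noteq> 0}"

text \<open>A representation of a finite group over the complex numbers is determined up to
  similarity by its character, so the choice below does not affect the determinant.\<close>

definition det_char ::
    "('a, 'b) monoid_scheme \<Rightarrow> ('a \<Rightarrow> complex) \<Rightarrow> 'a \<Rightarrow> complex" where
  "det_char G \<theta> =
     (\<lambda>g \<in> carrier G.
        det ((SOME \<rho>. \<exists>n. representation G n \<rho> \<and> character_of G n \<rho> = \<theta>) g))"

text \<open>The order of \<open>det_char G \<theta>\<close> in the group of linear characters of \<open>G\<close>.\<close>

definition det_order :: "('a, 'b) monoid_scheme \<Rightarrow> ('a \<Rightarrow> complex) \<Rightarrow> nat" where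
  "det_order G \<theta> = (LEAST k. 0 < k \<and> (\<forall>g \<in> carrier G. det_char G \<theta> g ^ k = 1))"

definition pi_special ::
    "nat set \<Rightarrow> ('a, 'b) monoid_scheme \<Rightarrow> ('a \<Rightarrow> complex) \<Rightarrow> bool" where
  "pi_special \<pi> H \<theta> \<longleftrightarrow>
     \<theta> \<in> Irr H \<and>
     (\<exists>n. \<theta> \<one>\<^bsub>H\<^esub> = of_nat n \<and> pi_number \<pi> n) \<and>
     (\<forall>S. subnormal H S \<longrightarrow>
        (\<forall>\<psi> \<in> irr_constituents (H\<lparr>carrier := S\<rparr>) (restrict \<theta> S).
           pi_number \<pi> (det_order (H\<lparr>carrier := S\<rparr>) \<psi>)))"

definition induced_char ::
    "('a, 'b) monoid_scheme \<Rightarrow> 'a set \<Rightarrow> ('a \<Rightarrow> complex) \<Rightarrow> 'a \<Rightarrow> complex" where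
  "induced_char G U \<theta> =
     (\<lambda>g \<in> carrier G.
        (\<Sum>x \<in> carrier G.
           if x \<otimes>\<^bsub>G\<^esub> g \<otimes>\<^bsub>G\<^esub> inv\<^bsub>G\<^esub> x \<in> U then \<theta> (x \<otimes>\<^bsub>G\<^esub> g \<otimes>\<^bsub>G\<^esub> inv\<^bsub>G\<^esub> x) else 0)
        / of_nat (card U))"

definition inflate_char ::
    "('a, 'b) monoid_scheme \<Rightarrow> 'a set \<Rightarrow> ('a set \<Rightarrow> complex) \<Rightarrow> 'a \<Rightarrow> complex" where
  "inflate_char G N \<theta> = (\<lambda>g \<in> carrier G. \<theta> (N #>\<^bsub>G\<^esub> g))"

definition lifts ::
    "nat set \<Rightarrow> ('a, 'b) monoid_scheme \<Rightarrow> ('a \<Rightarrow> complex) \<Rightarrow> ('a \<Rightarrow> complex) set" where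
  "lifts \<pi> G \<phi> = {\<psi> \<in> Irr G. restrict \<psi> (pi_elements \<pi> G) = \<phi>}"

end

theory Submission
  imports Defs "Jordan_Normal_Form.Spectral_Radius"
begin

text \<open>Since \<open>\<chi>\<close> vanishes off the centre of \<open>E\<close>, it has lifts \<open>\<psi>\<^sub>1\<close> and \<open>\<psi>\<^sub>2\<close> with \<open>\<psi>\<^sub>i\<close> nontrivial
  on \<open>V\<^sub>i\<close>: twist the representation of \<open>E\<close> by a character of \<open>V\<close> that is faithful on \<open>V\<^sub>i\<close> and
  trivial on the other factor. Suppose \<open>\<psi>\<^sub>i = (\<delta>\<gamma>\<^sub>i)\<^sup>G\<close> for a common pair \<open>(U, \<delta>)\<close>. Comparing degrees,
  \<open>U\<close> has index at most 3, so it contains \<open>V\<^sub>i\<close>. As \<open>\<delta>\<close> is 3-special, it is constant on the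
  7-group \<open>V\<^sub>i\<close>, so the \<open>U\<close>-invariant linear character \<open>\<gamma>\<^sub>i\<close> must be faithful on \<open>V\<^sub>i\<close> and \<open>U\<close>
  centralizes \<open>V\<^sub>i\<close>. For \<open>i = 1, 2\<close> together this puts \<open>U\<close> inside \<open>V \<times> (M\<^sub>1 \<inter> M\<^sub>2)\<close>, which has
  index 9.\<close>

section \<open>Matrices and irreducible representations\<close>

text \<open>The lifts are built as actual matrices on the space of the given representation
  \<open>\<sigma>\<close> of \<open>E\<close>. Elements \<open>m\<close> and \<open>e\<close> of
  \<open>E\<close> that do not commute have a central commutator, so \<open>\<sigma> m\<close> and
  \<open>\<sigma> e\<close> commute up to a primitive cube root of unity \<open>w\<close>. Hence
  \<open>\<sigma> e\<close> permutes the eigenspaces of \<open>\<sigma> m\<close> cyclically, and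
  \<open>V\<close> can act on these through three characters that \<open>e\<close> permutes in the
  same way. The new trace agrees with the old one at 3-elements \<open>(v, x)\<close> for two
  different reasons: if \<open>x\<close> lies in \<open>M\<close>, invariance of the character under
  \<open>M\<close> makes its value at \<open>v\<close> both a 7th root of unity and a root of unity
  of 3-power order, hence 1; if \<open>x\<close> is outside \<open>M\<close>, both traces vanish. At
  \<open>v\<close> itself the trace is \<open>n\<close> times the mean of three roots of unity,
  which is \<open>n\<close> only when all three are 1. For the contradiction, the induction formula
  is evaluated directly at the identity and at elements of the normal subgroup \<open>V1\<close>,
  where no Clifford theory is needed. The final clash is numerical: index at most 3 requires order
  at least 441, while \<open>V\<close> times the intersection of two maximal subgroups has order at
  most 147.\<close>

definition mtrace :: "nat \<Rightarrow> complex mat \<Rightarrow> complex" where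
  "mtrace n A = (\<Sum>i<n. A $$ (i, i))"

lemma mtrace_mult_comm:
  assumes "A \<in> carrier_mat n n" "B \<in> carrier_mat n n"
  shows "mtrace n (A * B) = mtrace n (B * A)"
proof -
  have "mtrace n (A * B) = (\<Sum>i<n. \<Sum>j<n. A $$ (i, j) * B $$ (j, i))"
    using assms by (auto simp: mtrace_def scalar_prod_def atLeast0LessThan intro!: sum.cong)
  also have "\<dots> = (\<Sum>j<n. \<Sum>i<n. A $$ (i, j) * B $$ (j, i))"
    by (rule sum.swap)
  also have "\<dots> = mtrace n (B * A)"
    using assms by (auto simp: mtrace_def scalar_prod_def atLeast0LessThan mult.commute intro!: sum.cong)
  finally show ?thesis .
qed

lemma mtrace_smult:
  "A \<in> carrier_mat n n \<Longrightarrow> mtrace n (c \<cdot>\<^sub>m A) = c * mtrace n A"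
  by (auto simp: mtrace_def sum_distrib_left intro!: sum.cong)

lemma mtrace_add:
  "A \<in> carrier_mat n n \<Longrightarrow> B \<in> carrier_mat n n \<Longrightarrow> mtrace n (A + B) = mtrace n A + mtrace n B"
  unfolding mtrace_def sum.distrib[symmetric] by (intro sum.cong) auto

lemma mtrace_one: "mtrace n (1\<^sub>m n) = of_nat n"
  by (simp add: mtrace_def)

lemma smult_smult_mat: "a \<cdot>\<^sub>m (b \<cdot>\<^sub>m A) = (a * b) \<cdot>\<^sub>m (A :: complex mat)"
  by (intro eq_matI) auto

text \<open>The general element of the algebra generated by \<open>A\<close> when \<open>A\<close>
  has order 3. Working with coefficients replaces a choice of eigenbasis.\<close>

definition quad_mat :: "nat \<Rightarrow> complex mat \<Rightarrow> complex \<Rightarrow> complex \<Rightarrow> complex \<Rightarrow> complex mat" where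
  "quad_mat n A a b c = a \<cdot>\<^sub>m 1\<^sub>m n + b \<cdot>\<^sub>m A + c \<cdot>\<^sub>m (A * A)"

lemma quad_mat_carrier [simp]:
  "A \<in> carrier_mat n n \<Longrightarrow> quad_mat n A a b c \<in> carrier_mat n n"
  by (simp add: quad_mat_def)

text \<open>Exponents of \<open>A\<close> are read modulo 3, so the coefficients multiply by cyclic
  convolution. This is the pattern matched later by \<open>fourier_convolution_3\<close>.\<close>

lemma quad_mat_mult:
  assumes A: "A \<in> carrier_mat n n" and A3: "A * A * A = 1\<^sub>m n"
  shows "quad_mat n A a b c * quad_mat n A a' b' c' =
    quad_mat n A (a * a' + b * c' + c * b') (a * b' + b * a' + c * c') (a * c' + b * b' + c * a')"
proof -
  have AA: "A * A \<in> carrier_mat n n" using A by simp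
  have 1: "A * (A * A) = 1\<^sub>m n" using A A3 by (metis assoc_mult_mat)
  have 2: "A * A * (A * A) = A"
    using A A3 AA by (metis assoc_mult_mat left_mult_one_mat)
  have "quad_mat n A a b c * quad_mat n A a' b' c' =
     a' \<cdot>\<^sub>m (a \<cdot>\<^sub>m 1\<^sub>m n + b \<cdot>\<^sub>m A + c \<cdot>\<^sub>m (A * A)) +
     b' \<cdot>\<^sub>m (a \<cdot>\<^sub>m A + b \<cdot>\<^sub>m (A * A) + c \<cdot>\<^sub>m 1\<^sub>m n) +
     c' \<cdot>\<^sub>m (a \<cdot>\<^sub>m (A * A) + b \<cdot>\<^sub>m 1\<^sub>m n + c \<cdot>\<^sub>m A)"
    unfolding quad_mat_def
    using A AA
    by (simp add: add_mult_distrib_mat[where nr = n and n = n and nc = n] mult_add_distrib_mat[where nr = n and n = n and nc = n]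
        mult_smult_distrib[where nr = n and n = n and nc = n] mult_smult_assoc_mat[where nr = n and n = n and nc = n] 1 2 A3)
  also have "\<dots> = quad_mat n A (a * a' + b * c' + c * b') (a * b' + b * a' + c * c') (a * c' + b * b' + c * a')"
    unfolding quad_mat_def using A AA
    by (intro eq_matI) (auto simp: algebra_simps)
  finally show ?thesis .
qed

text \<open>Each factor \<open>A\<close> that \<open>B\<close> passes contributes one factor
  \<open>w\<close>, hence the weights 1, \<open>w\<close>, \<open>w ^ 2\<close> on the
  coefficients.\<close>

lemma quad_mat_conj:
  assumes A: "A \<in> carrier_mat n n" and B: "B \<in> carrier_mat n n"
    and BA: "B * A = w \<cdot>\<^sub>m (A * B)"
  shows "B * quad_mat n A a b c = quad_mat n A a (w * b) (w ^ 2 * c) * B"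
proof -
  have AA: "A * A \<in> carrier_mat n n" using A by simp
  have "B * (A * A) = (w \<cdot>\<^sub>m (A * B)) * A"
    unfolding BA[symmetric] using A B by simp
  also have "\<dots> = w \<cdot>\<^sub>m (A * (B * A))"
    using A B by (simp add: mult_smult_assoc_mat[where nr = n and n = n and nc = n])
  also have "\<dots> = w ^ 2 \<cdot>\<^sub>m (A * A * B)"
    unfolding BA using A B by (simp add: mult_smult_distrib[where nr = n and n = n and nc = n] power2_eq_square smult_smult_mat)
  finally have BAA: "B * (A * A) = w ^ 2 \<cdot>\<^sub>m (A * A * B)" .
  show ?thesis
    unfolding quad_mat_def using A B AA
    by (simp add: add_mult_distrib_mat[where nr = n and n = n and nc = n] mult_add_distrib_mat[where nr = n and n = n and nc = n]
        mult_smult_distrib[where nr = n and n = n and nc = n] mult_smult_assoc_mat[where nr = n and n = n and nc = n] BA BAA smult_smult_mat mult.commute)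
qed

lemma quad_mat_one: "A \<in> carrier_mat n n \<Longrightarrow> quad_mat n A 1 0 0 = 1\<^sub>m n"
  by (intro eq_matI) (auto simp: quad_mat_def)

section \<open>Invariant subspaces and Schur's lemma\<close>

lemma subspaceI_vec:
  assumes "W \<subseteq> carrier_vec n" "0\<^sub>v n \<in> W"
    and "\<And>v w. v \<in> W \<Longrightarrow> w \<in> W \<Longrightarrow> v + w \<in> W"
    and "\<And>c v. v \<in> W \<Longrightarrow> c \<cdot>\<^sub>v v \<in> W"
  shows "subspace class_ring W (module_vec TYPE(complex) n)"
proof -
  interpret vec_space "TYPE(complex)" n .
  show ?thesis
    using assms by unfold_locales (auto simp: module_vec_simps)
qed

lemma eigenspace_subspace:
  assumes A: "A \<in> carrier_mat n n"
  shows "subspace class_ring {v \<in> carrier_vec n. A *\<^sub>v v = c \<cdot>\<^sub>v v} (module_vec TYPE(complex) n)"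
proof (rule subspaceI_vec)
  show "d \<cdot>\<^sub>v v \<in> {v \<in> carrier_vec n. A *\<^sub>v v = c \<cdot>\<^sub>v v}"
    if "v \<in> {v \<in> carrier_vec n. A *\<^sub>v v = c \<cdot>\<^sub>v v}" for d v
    using A that by (simp add: mult_mat_vec[of _ n n] smult_smult_assoc mult.commute)
next
  show "v + w \<in> {v \<in> carrier_vec n. A *\<^sub>v v = c \<cdot>\<^sub>v v}"
    if "v \<in> {v \<in> carrier_vec n. A *\<^sub>v v = c \<cdot>\<^sub>v v}" "w \<in> {v \<in> carrier_vec n. A *\<^sub>v v = c \<cdot>\<^sub>v v}" for v w
    using A that by (simp add: mult_add_distrib_mat_vec[of _ n n] smult_add_distrib_vec[of _ n])
next
  show "0\<^sub>v n \<in> {v \<in> carrier_vec n. A *\<^sub>v v = c \<cdot>\<^sub>v v}"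
    using A by (auto intro!: eq_vecI)
qed auto

text \<open>Over the complex numbers \<open>A\<close> has an eigenvalue; its eigenspace is invariant
  under every \<open>\<rho> g\<close> and nonzero, so it is the whole space.\<close>

lemma schur:
  assumes irr: "irreducible_representation G n \<rho>" and A: "A \<in> carrier_mat n n"
    and comm: "\<And>g. g \<in> carrier G \<Longrightarrow> A * \<rho> g = \<rho> g * A"
  obtains c where "A = c \<cdot>\<^sub>m 1\<^sub>m n"
proof -
  have n: "n > 0" and rho: "\<And>g. g \<in> carrier G \<Longrightarrow> \<rho> g \<in> carrier_mat n n"
    using irr by (auto simp: irreducible_representation_def representation_def)
  obtain c v where v: "v \<in> carrier_vec n" "v \<noteq> 0\<^sub>v n" "A *\<^sub>v v = c \<cdot>\<^sub>v v"
    using spectrum_non_empty[OF A n] A by (auto simp: spectrum_def eigenvalue_def eigenvector_def)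
  define W where "W = {v \<in> carrier_vec n. A *\<^sub>v v = c \<cdot>\<^sub>v v}"
  have "\<rho> g *\<^sub>v w \<in> W" if g: "g \<in> carrier G" and w: "w \<in> W" for g w
  proof -
    have wc: "w \<in> carrier_vec n" using w by (simp add: W_def)
    have "A *\<^sub>v (\<rho> g *\<^sub>v w) = (A * \<rho> g) *\<^sub>v w" using A rho[OF g] wc by simp
    also have "\<dots> = \<rho> g *\<^sub>v (A *\<^sub>v w)" using A rho[OF g] wc comm[OF g] by simp
    also have "\<dots> = c \<cdot>\<^sub>v (\<rho> g *\<^sub>v w)" using w rho[OF g] wc by (simp add: W_def mult_mat_vec)
    finally show ?thesis using rho[OF g] wc by (simp add: W_def)
  qed
  moreover have "subspace class_ring W (module_vec TYPE(complex) n)"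
    unfolding W_def by (rule eigenspace_subspace[OF A])
  ultimately have "W = {0\<^sub>v n} \<or> W = carrier_vec n"
    using irr unfolding irreducible_representation_def by blast
  hence W: "W = carrier_vec n" using v by (auto simp: W_def)
  have "A = c \<cdot>\<^sub>m 1\<^sub>m n"
  proof (rule eq_matI)
    fix i j assume ij: "i < dim_row (c \<cdot>\<^sub>m 1\<^sub>m n)" "j < dim_col (c \<cdot>\<^sub>m 1\<^sub>m n)"
    hence "unit_vec n j \<in> W" by (simp add: W)
    hence "A *\<^sub>v unit_vec n j = c \<cdot>\<^sub>v unit_vec n j" by (simp add: W_def)
    moreover have "A *\<^sub>v unit_vec n j = col A j" using A ij by (intro eq_vecI) auto
    ultimately have "col A j $ i = (c \<cdot>\<^sub>v unit_vec n j) $ i" by simp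
    thus "A $$ (i, j) = (c \<cdot>\<^sub>m 1\<^sub>m n) $$ (i, j)" using A ij by (auto simp: unit_vec_def)
  qed (use A in auto)
  thus ?thesis by (rule that)
qed

text \<open>When all operators are scalars every line is invariant; for \<open>n > 1\<close> the
  line through the first unit vector is proper and nonzero.\<close>

lemma irreducible_scalar_dim:
  assumes irr: "irreducible_representation G n \<rho>"
    and sc: "\<And>g. g \<in> carrier G \<Longrightarrow> \<exists>c. \<rho> g = c \<cdot>\<^sub>m 1\<^sub>m n"
  shows "n = 1"
proof (rule ccontr)
  assume "n \<noteq> 1"
  moreover have "n > 0" using irr by (simp add: irreducible_representation_def)
  ultimately have n: "n > 1" by simp
  define W where "W = {c \<cdot>\<^sub>v unit_vec n 0 | c. c \<in> (UNIV :: complex set)}"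
  have "subspace class_ring W (module_vec TYPE(complex) n)"
  proof (rule subspaceI_vec)
    show "0\<^sub>v n \<in> W" unfolding W_def by (auto intro!: exI[of _ 0])
    show "v + w \<in> W" if "v \<in> W" "w \<in> W" for v w
      using that unfolding W_def by (auto simp flip: add_smult_distrib_vec)
    show "c \<cdot>\<^sub>v v \<in> W" if "v \<in> W" for v c
      using that unfolding W_def by (auto simp: smult_smult_assoc)
  qed (auto simp: W_def)
  moreover have "\<rho> g *\<^sub>v w \<in> W" if g: "g \<in> carrier G" and w: "w \<in> W" for g w
  proof -
    obtain c where "\<rho> g = c \<cdot>\<^sub>m 1\<^sub>m n" using sc[OF g] by blast
    moreover have "w \<in> carrier_vec n" using w by (auto simp: W_def)
    ultimately have "\<rho> g *\<^sub>v w = c \<cdot>\<^sub>v w"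
      by (intro eq_vecI) auto
    thus ?thesis using w unfolding W_def by (auto simp: smult_smult_assoc)
  qed
  ultimately have "W = {0\<^sub>v n} \<or> W = carrier_vec n"
    using irr unfolding irreducible_representation_def by blast
  moreover have "unit_vec n 0 \<in> W" unfolding W_def by (auto intro!: exI[of _ 1])
  moreover have "unit_vec n 0 \<noteq> (0\<^sub>v n :: complex vec)" using n by auto
  ultimately have "unit_vec n 1 \<in> W" by auto
  then obtain c :: complex where "unit_vec n 1 = c \<cdot>\<^sub>v unit_vec n 0" unfolding W_def by blast
  hence "unit_vec n 1 $ 1 = (c \<cdot>\<^sub>v unit_vec n 0) $ 1" by simp
  thus False using n by simp
qed

lemma one_smult_mat: "1 \<cdot>\<^sub>m A = (A :: complex mat)"
  by (intro eq_matI) auto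

lemma quad_mat_commute:
  assumes "A \<in> carrier_mat n n" "B \<in> carrier_mat n n" "B * A = A * B"
  shows "B * quad_mat n A a b c = quad_mat n A a b c * B"
proof -
  have "B * A = 1 \<cdot>\<^sub>m (A * B)" using assms(3) by (simp add: one_smult_mat)
  from quad_mat_conj[OF assms(1,2) this] show ?thesis by simp
qed

text \<open>The trace is invariant under conjugation by the invertible matrix \<open>A\<close>,
  whose inverse is \<open>A * A\<close>, while this conjugation multiplies \<open>C\<close> by a
  scalar other than 1. It gives the vanishing of all traces below.\<close>

lemma mtrace_eq_zero:
  assumes C: "C \<in> carrier_mat n n" and A: "A \<in> carrier_mat n n" and A3: "A * A * A = 1\<^sub>m n"
    and CA: "C * A = w \<cdot>\<^sub>m (A * C)" and w: "w \<noteq> 1"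
  shows "mtrace n C = 0"
proof -
  have AA: "A * A \<in> carrier_mat n n" using A by simp
  have A3': "A * (A * A) = 1\<^sub>m n" using A A3 by simp
  have "mtrace n C = mtrace n (C * A * (A * A))"
    using A C AA by (simp add: assoc_mult_mat[of _ n n _ n _ n] A3')
  also have "\<dots> = w * mtrace n (A * (C * (A * A)))"
    unfolding CA using A C AA
    by (simp add: mult_smult_assoc_mat[where nr = n and n = n and nc = n]
        assoc_mult_mat[of _ n n _ n _ n] mtrace_smult[of _ n])
  also have "mtrace n (A * (C * (A * A))) = mtrace n (C * (A * A) * A)"
    using A C AA by (intro mtrace_mult_comm) auto
  also have "C * (A * A) * A = C" using A C AA A3 by (simp add: assoc_mult_mat[of _ n n _ n _ n] A3')
  finally show ?thesis using w by simp
qed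

section \<open>Extraspecial groups of order 27 and exponent 3\<close>

lemma (in group) centralizer_subgroup:
  assumes m: "m \<in> carrier G"
  shows "subgroup {x \<in> carrier G. x \<otimes> m = m \<otimes> x} G"
proof (rule subgroupI)
  fix a assume "a \<in> {x \<in> carrier G. x \<otimes> m = m \<otimes> x}"
  thus "inv a \<in> {x \<in> carrier G. x \<otimes> m = m \<otimes> x}"
  proof safe
    assume a: "a \<in> carrier G" "a \<otimes> m = m \<otimes> a"
    have "inv a \<otimes> m = inv a \<otimes> (m \<otimes> a) \<otimes> inv a" using a(1) m by (simp add: m_assoc)
    also have "\<dots> = m \<otimes> inv a"
      unfolding a(2)[symmetric] using a(1) m by (simp add: m_assoc[symmetric])
    finally show "inv a \<otimes> m = m \<otimes> inv a" .
  qed auto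
next
  fix a b assume "a \<in> {x \<in> carrier G. x \<otimes> m = m \<otimes> x}" "b \<in> {x \<in> carrier G. x \<otimes> m = m \<otimes> x}"
  thus "a \<otimes> b \<in> {x \<in> carrier G. x \<otimes> m = m \<otimes> x}"
  proof safe
    assume ab: "a \<in> carrier G" "b \<in> carrier G" "a \<otimes> m = m \<otimes> a" "b \<otimes> m = m \<otimes> b"
    have "a \<otimes> b \<otimes> m = a \<otimes> (m \<otimes> b)" using ab m by (simp add: m_assoc)
    also have "\<dots> = a \<otimes> m \<otimes> b" using ab(1,2) m by (simp add: m_assoc)
    also have "\<dots> = m \<otimes> (a \<otimes> b)" unfolding ab(3) using ab(1,2) m by (simp add: m_assoc)
    finally show "a \<otimes> b \<otimes> m = m \<otimes> (a \<otimes> b)" .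
  qed auto
qed (use m in auto)

lemma (in group) center_subgroup: "subgroup (group_center G) G"
proof -
  have Z: "group_center G = carrier G \<inter> (\<Inter>m \<in> carrier G. {x \<in> carrier G. x \<otimes> m = m \<otimes> x})"
    by (auto simp: group_center_def)
  show ?thesis
  proof (rule subgroupI)
    fix a assume "a \<in> group_center G"
    thus "inv a \<in> group_center G"
      unfolding Z using subgroup.m_inv_closed[OF centralizer_subgroup] by blast
  next
    fix a b assume "a \<in> group_center G" "b \<in> group_center G"
    thus "a \<otimes> b \<in> group_center G"
      unfolding Z using subgroup.m_closed[OF centralizer_subgroup] m_closed by blast
  qed (auto simp: group_center_def)
qed

lemma (in group) commutator_in_derived:
  assumes "x \<in> carrier G" "y \<in> carrier G"
  shows "x \<otimes> y \<otimes> inv x \<otimes> inv y \<in> derived G (carrier G)"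
  unfolding derived_def using assms by (intro generate.incl) auto

lemma (in group) commutator_mult:
  assumes "x \<in> carrier G" "y \<in> carrier G"
  shows "x \<otimes> y = x \<otimes> y \<otimes> inv x \<otimes> inv y \<otimes> (y \<otimes> x)"
proof -
  have "x \<otimes> y \<otimes> inv x \<otimes> inv y = x \<otimes> y \<otimes> inv (y \<otimes> x)"
    using assms by (simp add: inv_mult_group m_assoc)
  thus ?thesis using assms by (simp add: m_assoc[of "x \<otimes> y" "inv (y \<otimes> x)" "y \<otimes> x"])
qed

locale extraspecial_27 = group E for E (structure) +
  assumes extraspecial: "extraspecial 3 E"
    and card_E: "Coset.order E = 3 ^ 3"
    and exponent_E: "group_exponent E = 3"
begin

abbreviation "Z \<equiv> group_center E"

lemma fin: "finite (carrier E)"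
  using card_E order_gt_0_iff_finite by force

lemma cube:
  assumes "x \<in> carrier E"
  shows "x \<otimes> x \<otimes> x = \<one>"
proof -
  \<comment> \<open>The exponent is defined by \<open>LEAST\<close>, so some admissible number must
    be exhibited before \<open>LeastI\<close> applies; the group order is one.\<close>
  have "0 < Coset.order E \<and> (\<forall>x \<in> carrier E. x [^] Coset.order E = \<one>)"
    using card_E pow_order_eq_1 by auto
  hence "0 < group_exponent E \<and> (\<forall>x \<in> carrier E. x [^] group_exponent E = \<one>)"
    unfolding group_exponent_def by (rule LeastI)
  hence "x [^] (3 :: nat) = \<one>" using assms exponent_E by auto
  thus ?thesis using assms by (simp add: numeral_3_eq_3)
qed

lemma inv_eq_square: "x \<in> carrier E \<Longrightarrow> inv x = x \<otimes> x"
  using cube by (simp add: inv_equality)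

lemma card_center: "card Z = 3" and center_derived: "Z = derived E (carrier E)"
  and center_frattini: "Z = frattini E"
  using extraspecial by (auto simp: extraspecial_def)

lemma card_subgroup_cases:
  assumes H: "subgroup H E"
  shows "card H = 1 \<or> card H = 3 \<or> card H = 9 \<or> card H = 27"
proof -
  have "card H dvd 3 ^ 3" using lagrange[OF H] card_E by (metis dvd_triv_right)
  moreover have "Factorial_Ring.prime (3 :: nat)" by simp
  ultimately obtain k where k: "k \<le> 3" "card H = 3 ^ k"
    using divides_primepow_nat by blast
  hence "k = 0 \<or> k = 1 \<or> k = 2 \<or> k = 3" by auto
  thus ?thesis using k by auto
qed

lemma card_subgroup_above_center:
  assumes H: "subgroup H E" "Z \<subset> H" "H \<noteq> carrier E"
  shows "card H = 9"
proof -
  have sub: "H \<subseteq> carrier E" using H(1) by (rule subgroup.subset)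
  have "finite H" using fin sub finite_subset by blast
  hence "3 < card H" using H(2) card_center psubset_card_mono by metis
  moreover have "card H < 27"
    using sub H(3) fin psubset_card_mono[of "carrier E" H] card_E by (auto simp: Coset.order_def)
  ultimately show ?thesis using card_subgroup_cases[OF H(1)] by auto
qed

lemma center_subset_maximal:
  assumes "maximal_subgroup M E"
  shows "Z \<subseteq> M"
  using assms center_frattini by (auto simp: frattini_def)

text \<open>The centre is the Frattini subgroup and so lies in \<open>M'\<close>. If
  \<open>M\<close> were the centre, it would be contained in the proper subgroup \<open>M'\<close>,
  and maximality would force \<open>M = M'\<close>.\<close>

lemma maximal_neq_center:
  assumes M: "maximal_subgroup M E" "maximal_subgroup M' E" "M \<noteq> M'"
  shows "M \<noteq> Z"
  using M center_subset_maximal[OF M(2)] by (auto simp: maximal_subgroup_def)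

text \<open>Both groups are proper and strictly contain the centre, so both have order 9. Their
  intersection contains \<open>m\<close> besides the centre, so it has order 9 as well and equals
  both. Commutativity of \<open>M\<close> is not presupposed.\<close>

lemma centralizer_eq_maximal:
  assumes M: "subgroup M E" "Z \<subseteq> M" "M \<noteq> carrier E" and m: "m \<in> M - Z"
  shows "{x \<in> carrier E. x \<otimes> m = m \<otimes> x} = M"
proof -
  let ?C = "{x \<in> carrier E. x \<otimes> m = m \<otimes> x}"
  have mc: "m \<in> carrier E" using m M(1) subgroup.subset by blast
  have C: "subgroup ?C E" by (rule centralizer_subgroup[OF mc])
  have ZC: "Z \<subset> ?C" using m mc by (auto simp: group_center_def)
  have "?C \<noteq> carrier E"
  proof
    assume "?C = carrier E"
    hence "\<forall>g \<in> carrier E. m \<otimes> g = g \<otimes> m" by (metis (mono_tags, lifting) mem_Collect_eq)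
    thus False using m mc by (auto simp: group_center_def)
  qed
  hence C9: "card ?C = 9" using C ZC card_subgroup_above_center by blast
  have M9: "card M = 9" using M m by (intro card_subgroup_above_center) auto
  have "subgroup (?C \<inter> M) E" using C M(1) by (rule subgroups_Inter_pair)
  moreover have "Z \<subset> ?C \<inter> M" using ZC M(2) m mc by auto
  ultimately have "card (?C \<inter> M) = 9"
    using \<open>?C \<noteq> carrier E\<close> by (intro card_subgroup_above_center) auto
  moreover have "finite M" using fin M(1) subgroup.subset finite_subset by blast
  moreover have "finite ?C" using fin by simp
  ultimately have "?C \<inter> M = M" "?C \<inter> M = ?C"
    using C9 M9 by (intro card_subset_eq; simp)+
  thus ?thesis by simp
qed

text \<open>\<open>M\<close> contains the centre, which is the derived subgroup, hence all
  commutators.\<close>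

lemma maximal_conj_closed:
  assumes M: "subgroup M E" "Z \<subseteq> M" and x: "x \<in> carrier E" "m \<in> M"
  shows "x \<otimes> m \<otimes> inv x \<in> M"
proof -
  have mc: "m \<in> carrier E" using M x subgroup.subset by blast
  have "x \<otimes> m \<otimes> inv x \<otimes> inv m \<in> M"
    using commutator_in_derived[OF x(1) mc] M(2) center_derived by auto
  hence "x \<otimes> m \<otimes> inv x \<otimes> inv m \<otimes> m \<in> M" using M(1) x(2) by (simp add: subgroup.m_closed)
  thus ?thesis using x mc by (simp add: m_assoc)
qed

section \<open>Irreducible representations of the extraspecial group\<close>

lemma center_acts_by_scalars:
  assumes irr: "irreducible_representation E n \<sigma>" and z: "z \<in> Z"
  obtains c where "\<sigma> z = c \<cdot>\<^sub>m 1\<^sub>m n"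
proof (rule schur[OF irr])
  have rep: "representation E n \<sigma>" using irr by (simp add: irreducible_representation_def)
  show "\<sigma> z \<in> carrier_mat n n" using rep z by (auto simp: representation_def group_center_def)
  show "\<sigma> z * \<sigma> g = \<sigma> g * \<sigma> z" if "g \<in> carrier E" for g
  proof -
    have zc: "z \<in> carrier E" "z \<otimes> g = g \<otimes> z" using z that by (auto simp: group_center_def)
    have "\<sigma> z * \<sigma> g = \<sigma> (z \<otimes> g)" using rep zc(1) that by (simp add: representation_def)
    also have "\<dots> = \<sigma> g * \<sigma> z" unfolding zc(2) using rep zc(1) that by (simp add: representation_def)
    finally show ?thesis .
  qed
qed (rule that)

text \<open>The centre has order 3, so a nontrivial kernel on it is all of it. Then commutators act
  trivially, the image is commutative, Schur's lemma makes every operator a scalar, and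
  \<open>n = 1\<close> follows.\<close>

lemma center_acts_faithfully:
  assumes irr: "irreducible_representation E n \<sigma>" and n: "n \<noteq> 1"
    and z: "z \<in> Z" "z \<noteq> \<one>"
  shows "\<sigma> z \<noteq> 1\<^sub>m n"
proof
  assume triv: "\<sigma> z = 1\<^sub>m n"
  have rep: "representation E n \<sigma>" using irr by (simp add: irreducible_representation_def)
  have carr: "\<sigma> x \<in> carrier_mat n n" if "x \<in> carrier E" for x
    using rep that by (auto simp: representation_def)
  have mult: "\<sigma> (x \<otimes> y) = \<sigma> x * \<sigma> y" if "x \<in> carrier E" "y \<in> carrier E" for x y
    using rep that by (auto simp: representation_def)
  have one: "\<sigma> \<one> = 1\<^sub>m n" using rep by (auto simp: representation_def)
  have Zc: "Z \<subseteq> carrier E" by (auto simp: group_center_def)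
  define K where "K = {z \<in> Z. \<sigma> z = 1\<^sub>m n}"
  have "subgroup K E"
  proof (rule subgroupI)
    fix a assume "a \<in> K"
    thus "inv a \<in> K" using Zc subgroup.m_closed[OF center_subgroup]
      by (auto simp: K_def inv_eq_square mult subsetD)
  next
    fix a b assume "a \<in> K" "b \<in> K"
    thus "a \<otimes> b \<in> K" using Zc subgroup.m_closed[OF center_subgroup]
      by (auto simp: K_def mult subsetD)
  qed (use Zc triv z in \<open>auto simp: K_def\<close>)
  have finZ: "finite Z" using Zc fin finite_subset by blast
  have "{\<one>, z} \<subseteq> K"
    using z triv one subgroup.one_closed[OF center_subgroup] by (auto simp: K_def)
  hence "card {\<one>, z} \<le> card K" using finZ by (intro card_mono) (auto simp: K_def)
  moreover have "card K \<le> card Z" using finZ by (intro card_mono) (auto simp: K_def)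
  ultimately have "card K = card Z"
    using card_subgroup_cases[OF \<open>subgroup K E\<close>] card_center z by auto
  hence "K = Z" using finZ by (intro card_subset_eq) (auto simp: K_def)
  hence Z1: "\<sigma> y = 1\<^sub>m n" if "y \<in> Z" for y using that by (auto simp: K_def)
  have comm: "\<sigma> x * \<sigma> y = \<sigma> y * \<sigma> x" if xy: "x \<in> carrier E" "y \<in> carrier E" for x y
  proof -
    let ?c = "x \<otimes> y \<otimes> inv x \<otimes> inv y"
    have c: "?c \<in> Z" using commutator_in_derived[OF xy] center_derived by simp
    have "x \<otimes> y = ?c \<otimes> (y \<otimes> x)" by (rule commutator_mult[OF xy])
    hence "\<sigma> x * \<sigma> y = \<sigma> ?c * (\<sigma> y * \<sigma> x)"
      using xy c Zc by (metis mult m_closed subsetD)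
    thus ?thesis using Z1[OF c] carr[OF xy(1)] carr[OF xy(2)] by simp
  qed
  have "\<exists>c. \<sigma> g = c \<cdot>\<^sub>m 1\<^sub>m n" if g: "g \<in> carrier E" for g
    using schur[OF irr carr[OF g]] comm g by metis
  hence "n = 1" by (rule irreducible_scalar_dim[OF irr])
  thus False using n by simp
qed

text \<open>The commutator of \<open>x\<close> and \<open>m\<close> is central and nontrivial, so it
  acts by a scalar \<open>w\<close> other than 1; its cube is the identity, which gives
  \<open>w ^ 3 = 1\<close>.\<close>

lemma commutation_scalar:
  assumes irr: "irreducible_representation E n \<sigma>" and n: "n \<noteq> 1"
    and x: "x \<in> carrier E" and m: "m \<in> carrier E" and xm: "x \<otimes> m \<noteq> m \<otimes> x"
  obtains w where "w \<noteq> 1" "w ^ 3 = 1" "\<sigma> x * \<sigma> m = w \<cdot>\<^sub>m (\<sigma> m * \<sigma> x)"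
proof -
  have rep: "representation E n \<sigma>" using irr by (simp add: irreducible_representation_def)
  have carr: "\<sigma> x \<in> carrier_mat n n" if "x \<in> carrier E" for x
    using rep that by (auto simp: representation_def)
  have mult: "\<sigma> (x \<otimes> y) = \<sigma> x * \<sigma> y" if "x \<in> carrier E" "y \<in> carrier E" for x y
    using rep that by (auto simp: representation_def)
  have one: "\<sigma> \<one> = 1\<^sub>m n" using rep by (auto simp: representation_def)
  have n0: "n > 0" using irr by (simp add: irreducible_representation_def)
  define z where "z = x \<otimes> m \<otimes> inv x \<otimes> inv m"
  have z: "z \<in> Z" unfolding z_def using commutator_in_derived[OF x m] center_derived by simp
  have zc: "z \<in> carrier E" using x m by (simp add: z_def)
  have xz: "x \<otimes> m = z \<otimes> (m \<otimes> x)" unfolding z_def by (rule commutator_mult[OF x m])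
  hence "z \<noteq> \<one>" using xm x m by auto
  obtain w where w: "\<sigma> z = w \<cdot>\<^sub>m 1\<^sub>m n" using center_acts_by_scalars[OF irr z] .
  have "w \<noteq> 1" using center_acts_faithfully[OF irr n z \<open>z \<noteq> \<one>\<close>] w by auto
  moreover have "w ^ 3 = 1"
  proof -
    have "1\<^sub>m n = \<sigma> z * \<sigma> z * \<sigma> z" using cube[OF zc] one mult zc by (metis m_closed)
    also have "\<dots> = w ^ 3 \<cdot>\<^sub>m 1\<^sub>m n"
      unfolding w by (simp add: mult_smult_distrib[where nr = n and n = n and nc = n]
          smult_smult_mat power3_eq_cube mult.assoc)
    finally have "(1\<^sub>m n) $$ (0, 0) = (w ^ 3 \<cdot>\<^sub>m 1\<^sub>m n) $$ (0, 0)" by simp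
    thus ?thesis using n0 by simp
  qed
  moreover have "\<sigma> x * \<sigma> m = w \<cdot>\<^sub>m (\<sigma> m * \<sigma> x)"
  proof -
    have "\<sigma> x * \<sigma> m = \<sigma> z * (\<sigma> m * \<sigma> x)" using xz mult x m zc by (metis m_closed)
    thus ?thesis unfolding w using carr[OF x] carr[OF m]
      by (simp add: mult_smult_assoc_mat[where nr = n and n = n and nc = n])
  qed
  ultimately show ?thesis by (rule that)
qed

end

section \<open>Construction of lifts\<close>

locale semidirect = E: group E + V: group V
  for E :: "('e, 'c) monoid_scheme" and V :: "('v, 'd) monoid_scheme" +
  fixes \<alpha> :: "'e \<Rightarrow> 'v \<Rightarrow> 'v"
  assumes action_hom: "\<alpha> \<in> hom E (AutoGroup V)"
begin

abbreviation "G \<equiv> semidirect_product V E \<alpha>"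

lemma action_auto: "x \<in> carrier E \<Longrightarrow> \<alpha> x \<in> auto V"
  using action_hom by (auto simp: hom_def AutoGroup_def)

lemma action_closed: "x \<in> carrier E \<Longrightarrow> v \<in> carrier V \<Longrightarrow> \<alpha> x v \<in> carrier V"
  using action_auto[of x] by (auto simp: auto_def hom_def)

lemma action_mult:
  "x \<in> carrier E \<Longrightarrow> v \<in> carrier V \<Longrightarrow> w \<in> carrier V \<Longrightarrow> \<alpha> x (v \<otimes>\<^bsub>V\<^esub> w) = \<alpha> x v \<otimes>\<^bsub>V\<^esub> \<alpha> x w"
  using action_auto[of x] by (auto simp: auto_def hom_def)

lemma action_comp:
  assumes "x \<in> carrier E" "y \<in> carrier E" "v \<in> carrier V"
  shows "\<alpha> (x \<otimes>\<^bsub>E\<^esub> y) v = \<alpha> x (\<alpha> y v)"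
proof -
  have "\<alpha> (x \<otimes>\<^bsub>E\<^esub> y) = \<alpha> x \<otimes>\<^bsub>AutoGroup V\<^esub> \<alpha> y"
    using action_hom assms by (auto simp: hom_def)
  also have "\<dots> = compose (carrier V) (\<alpha> x) (\<alpha> y)"
    using action_auto[OF assms(1)] action_auto[OF assms(2)]
    by (simp add: AutoGroup_def BijGroup_def auto_def)
  finally show ?thesis using assms by (simp add: compose_def)
qed

lemma action_one: "v \<in> carrier V \<Longrightarrow> \<alpha> \<one>\<^bsub>E\<^esub> v = v"
proof -
  assume v: "v \<in> carrier V"
  have "group_hom E (AutoGroup V) \<alpha>"
    using action_hom E.is_group V.AutoGroup by (simp add: group_hom_def group_hom_axioms_def)
  hence "\<alpha> \<one>\<^bsub>E\<^esub> = \<one>\<^bsub>AutoGroup V\<^esub>" by (rule group_hom.hom_one)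
  thus ?thesis using v by (simp add: AutoGroup_def BijGroup_def)
qed

lemma action_by_one: "x \<in> carrier E \<Longrightarrow> \<alpha> x \<one>\<^bsub>V\<^esub> = \<one>\<^bsub>V\<^esub>"
  using action_mult[of x "\<one>\<^bsub>V\<^esub>" "\<one>\<^bsub>V\<^esub>"] action_closed[of x "\<one>\<^bsub>V\<^esub>"]
  by (simp add: V.l_cancel_one')

lemma carrier_semidirect: "carrier G = carrier V \<times> carrier E"
  by (simp add: semidirect_product_def)

lemma mult_semidirect: "(v, x) \<otimes>\<^bsub>G\<^esub> (w, y) = (v \<otimes>\<^bsub>V\<^esub> \<alpha> x w, x \<otimes>\<^bsub>E\<^esub> y)"
  by (simp add: semidirect_product_def)

lemma one_semidirect: "\<one>\<^bsub>G\<^esub> = (\<one>\<^bsub>V\<^esub>, \<one>\<^bsub>E\<^esub>)"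
  by (simp add: semidirect_product_def)

lemmas semidirect_simps = carrier_semidirect mult_semidirect one_semidirect

lemma group_semidirect: "group G"
proof (rule groupI)
  fix a assume "a \<in> carrier G"
  then obtain v x where a: "a = (v, x)" "v \<in> carrier V" "x \<in> carrier E"
    by (auto simp: carrier_semidirect)
  have "\<alpha> (inv\<^bsub>E\<^esub> x) (inv\<^bsub>V\<^esub> v) \<otimes>\<^bsub>V\<^esub> \<alpha> (inv\<^bsub>E\<^esub> x) v = \<one>\<^bsub>V\<^esub>"
    using a by (simp add: action_mult[symmetric] action_by_one)
  thus "\<exists>b \<in> carrier G. b \<otimes>\<^bsub>G\<^esub> a = \<one>\<^bsub>G\<^esub>"
    using a by (intro bexI[of _ "(\<alpha> (inv\<^bsub>E\<^esub> x) (inv\<^bsub>V\<^esub> v), inv\<^bsub>E\<^esub> x)"])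
      (auto simp: semidirect_simps action_closed)
qed (auto simp: semidirect_simps action_closed action_mult action_comp action_one V.m_assoc E.m_assoc)

end

section \<open>Roots of unity and the Fourier transform on the cyclic group of order 3\<close>

lemma norm_root_of_unity:
  assumes "(z :: complex) ^ Suc n = 1"
  shows "norm z = 1"
proof -
  have "norm z ^ Suc n = 1 ^ Suc n" using assms by (metis norm_one norm_power power_one)
  thus ?thesis by (rule power_inject_base) auto
qed

text \<open>Equality case of the triangle inequality: three real parts bounded by 1 with sum 3 are
  all equal to 1.\<close>

lemma sum_three_unit_eq_3:
  assumes "norm x = 1" "norm y = 1" "norm z = 1" "x + y + z = (3 :: complex)"
  shows "x = 1"
proof -
  have "Re x \<le> 1" "Re y \<le> 1" "Re z \<le> 1"
    using complex_Re_le_cmod[of x] complex_Re_le_cmod[of y] complex_Re_le_cmod[of z] assms by auto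
  moreover have "Re x + Re y + Re z = 3" using assms(4) by (metis plus_complex.simps(1) complex_Re_numeral)
  ultimately have "Re x = 1" by linarith
  moreover have "(Re x)\<^sup>2 + (Im x)\<^sup>2 = 1" using assms(1) by (metis cmod_power2 one_power2)
  ultimately show ?thesis by (simp add: complex_eq_iff)
qed

lemma power_coprime_eq_1:
  fixes z :: "'a :: field"
  assumes "z ^ m = 1" "z ^ n = 1" "coprime m n" "0 < m"
  shows "z = 1"
proof -
  obtain x y where "m * x = n * y + gcd m n"
    using bezout_nat[of m n] assms(4) by auto
  hence "m * x = n * y + 1" using assms(3) by simp
  hence "(z ^ m) ^ x = (z ^ n) ^ y * z" by (metis power_add power_mult power_one_right)
  thus ?thesis using assms by simp
qed

lemma coprime_pi_number:
  assumes "pi_number {p} k" "Factorial_Ring.prime q" "q \<noteq> p"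
  shows "coprime k q"
proof -
  have "\<not> q dvd k" using assms by (auto simp: pi_number_def)
  hence "coprime q k" by (rule prime_imp_coprime[OF assms(2)])
  thus ?thesis by (simp add: coprime_commute)
qed

text \<open>The discrete Fourier transform on the integers modulo 3 turns pointwise products into
  convolutions. The three combinations of \<open>x\<close>, \<open>y\<close>, \<open>z\<close> are
  the coefficients of the polynomial of degree at most 2 with values \<open>x\<close>,
  \<open>y\<close>, \<open>z\<close> at 1, \<open>w\<close>, \<open>w ^ 2\<close>.\<close>

lemma fourier_convolution_3:
  fixes w :: complex
  assumes w: "1 + w + w ^ 2 = 0"
  shows "(x * x' + y * y' + z * z') / 3 =
      (x + y + z) / 3 * ((x' + y' + z') / 3)
      + (x + w ^ 2 * y + w * z) / 3 * ((x' + w * y' + w ^ 2 * z') / 3)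
      + (x + w * y + w ^ 2 * z) / 3 * ((x' + w ^ 2 * y' + w * z') / 3)" (is ?A)
    and "(x * x' + w ^ 2 * (y * y') + w * (z * z')) / 3 =
      (x + y + z) / 3 * ((x' + w ^ 2 * y' + w * z') / 3)
      + (x + w ^ 2 * y + w * z) / 3 * ((x' + y' + z') / 3)
      + (x + w * y + w ^ 2 * z) / 3 * ((x' + w * y' + w ^ 2 * z') / 3)" (is ?B)
    and "(x * x' + w * (y * y') + w ^ 2 * (z * z')) / 3 =
      (x + y + z) / 3 * ((x' + w * y' + w ^ 2 * z') / 3)
      + (x + w ^ 2 * y + w * z) / 3 * ((x' + w ^ 2 * y' + w * z') / 3)
      + (x + w * y + w ^ 2 * z) / 3 * ((x' + y' + z') / 3)" (is ?C)
proof -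
  have div: "d / 3 = p / 3 * (q / 3) + r / 3 * (s / 3) + t / 3 * (u / 3)"
    if "3 * d = p * q + r * s + t * u" for d p q r s t u :: complex
  proof -
    have "p / 3 * (q / 3) + r / 3 * (s / 3) + t / 3 * (u / 3) = (3 * d) / 9"
      unfolding that by (simp add: add_divide_distrib)
    thus ?thesis by simp
  qed
  have w2: "w ^ 2 = - 1 - w" using w by (simp add: algebra_simps eq_neg_iff_add_eq_0)
  have ww: "w * w = - 1 - w" using w2 by (simp add: power2_eq_square)
  \<comment> \<open>Right-nested form of \<open>ww\<close>, which is the shape left by
    \<open>algebra_simps\<close>; together these rules reduce every power of \<open>w\<close> to
    degree at most 1.\<close>
  have ww': "w * (w * t) = - t - w * t" for t
    using ww by (simp add: mult.assoc[symmetric] left_diff_distrib)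
  show ?A by (rule div) (simp add: w2 algebra_simps ww ww')
  show ?B by (rule div) (simp add: w2 algebra_simps ww ww')
  show ?C by (rule div) (simp add: w2 algebra_simps ww ww')
qed

locale extraspecial_27_action = extraspecial_27 E + semidirect E V \<alpha>
  for E :: "('e, 'c) monoid_scheme" (structure) and V :: "('v, 'd) monoid_scheme" and \<alpha>

text \<open>The lift is \<open>(v, x) \<mapsto> D v * \<sigma> x\<close>. For \<open>m \<in> M - Z\<close> the matrix \<open>A = \<sigma> m\<close> has the three
  eigenspaces that \<open>\<sigma> e\<close> permutes cyclically for \<open>e \<notin> M\<close>, and \<open>D v\<close> acts on them through
  \<open>\<lambda>\<close> and its two \<open>e\<close>-conjugates; expressing \<open>D v\<close> as a polynomial in \<open>A\<close> avoids choosing a basis.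
  Irreducibility is inherited from \<open>\<sigma>\<close>, the restriction to \<open>E\<close>.\<close>

lemma (in extraspecial_27_action) lift_representation:
  fixes lam :: "'v \<Rightarrow> complex"
  assumes irr: "irreducible_representation E n \<sigma>" and n: "n \<noteq> 1"
    and M: "maximal_subgroup M E" "M \<noteq> Z"
    and lam_mult: "\<And>v w. v \<in> carrier V \<Longrightarrow> w \<in> carrier V \<Longrightarrow> lam (v \<otimes>\<^bsub>V\<^esub> w) = lam v * lam w"
    and lam7: "\<And>v. v \<in> carrier V \<Longrightarrow> lam v ^ 7 = 1"
    and lam_inv: "\<And>m v. m \<in> M \<Longrightarrow> v \<in> carrier V \<Longrightarrow> lam (\<alpha> m v) = lam v"
  obtains \<rho> where "irreducible_representation G n \<rho>"
    and "\<And>v x. (v, x) \<in> pi_elements {3} G \<Longrightarrow> mtrace n (\<rho> (v, x)) = mtrace n (\<sigma> x)"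
    and "\<And>v. v \<in> carrier V \<Longrightarrow> lam v \<noteq> 1 \<Longrightarrow> mtrace n (\<rho> (v, \<one>)) \<noteq> of_nat n"
proof -
  have rep: "representation E n \<sigma>" and n0: "n > 0"
    using irr by (auto simp: irreducible_representation_def)
  have carr [simp]: "\<sigma> x \<in> carrier_mat n n" if "x \<in> carrier E" for x
    using rep that by (auto simp: representation_def)
  have mult_carr [simp]: "P * Q \<in> carrier_mat n n"
    if "P \<in> carrier_mat n n" "Q \<in> carrier_mat n n" for P Q :: "complex mat"
    using that by (rule mult_carrier_mat)
  have mult: "\<sigma> (x \<otimes> y) = \<sigma> x * \<sigma> y" if "x \<in> carrier E" "y \<in> carrier E" for x y
    using rep that by (auto simp: representation_def)
  have one: "\<sigma> \<one> = 1\<^sub>m n" using rep by (auto simp: representation_def)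
  have Msub: "subgroup M E" "M \<noteq> carrier E" and ZM: "Z \<subseteq> M"
    using M(1) center_subset_maximal by (auto simp: maximal_subgroup_def)
  have Mc: "m \<in> carrier E" if "m \<in> M" for m using that Msub subgroup.subset by blast
  obtain m where m: "m \<in> M - Z" using M(2) ZM by blast
  have mc: "m \<in> carrier E" using m Mc by simp
  have cent: "{x \<in> carrier E. x \<otimes> m = m \<otimes> x} = M"
    by (rule centralizer_eq_maximal[OF Msub(1) ZM Msub(2) m])
  obtain e where e: "e \<in> carrier E" "e \<notin> M" using Msub subgroup.subset by blast
  define A where "A = \<sigma> m"
  have A [simp]: "A \<in> carrier_mat n n" unfolding A_def using mc by simp
  have cube_mat: "\<sigma> x * \<sigma> x * \<sigma> x = 1\<^sub>m n" if "x \<in> carrier E" for x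
    using cube[OF that] one mult that by (metis m_closed)
  have A3: "A * A * A = 1\<^sub>m n" unfolding A_def by (rule cube_mat[OF mc])
  have "e \<otimes> m \<noteq> m \<otimes> e" using e cent by blast
  then obtain w where w: "w \<noteq> 1" "w ^ 3 = 1" and BA: "\<sigma> e * A = w \<cdot>\<^sub>m (A * \<sigma> e)"
    unfolding A_def using commutation_scalar[OF irr n e(1) mc] by metis
  have w_sum: "1 + w + w ^ 2 = 0"
  proof -
    have "(w - 1) * (1 + w + w ^ 2) = w ^ 3 - 1" by (simp add: algebra_simps power2_eq_square power3_eq_cube)
    thus ?thesis using w by simp
  qed

  define l1 where "l1 = (\<lambda>v. lam (\<alpha> e v))"
  define l2 where "l2 = (\<lambda>v. lam (\<alpha> e (\<alpha> e v)))"
  \<comment> \<open>Interpolation: \<open>D v\<close> is the polynomial in \<open>A\<close> that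
    acts as \<open>lam v\<close>, \<open>l1 v\<close>, \<open>l2 v\<close> on the eigenspaces of
    \<open>A\<close> for 1, \<open>w\<close>, \<open>w ^ 2\<close>.\<close>
  define a where "a = (\<lambda>v. (lam v + l1 v + l2 v) / 3)"
  define b where "b = (\<lambda>v. (lam v + w ^ 2 * l1 v + w * l2 v) / 3)"
  define c where "c = (\<lambda>v. (lam v + w * l1 v + w ^ 2 * l2 v) / 3)"
  define D where "D = (\<lambda>v. quad_mat n A (a v) (b v) (c v))"
  have D [simp]: "D v \<in> carrier_mat n n" for v by (simp add: D_def)
  have l_mult: "l1 (v \<otimes>\<^bsub>V\<^esub> v') = l1 v * l1 v'" "l2 (v \<otimes>\<^bsub>V\<^esub> v') = l2 v * l2 v'"
    if "v \<in> carrier V" "v' \<in> carrier V" for v v'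
    using that e by (auto simp: l1_def l2_def action_mult action_closed lam_mult)
  have l7: "l1 v ^ 7 = 1" "l2 v ^ 7 = 1" if "v \<in> carrier V" for v
    using that e by (auto simp: l1_def l2_def action_closed lam7)
  \<comment> \<open>Moving \<open>e\<close> past \<open>x\<close> replaces \<open>x\<close> by its
    conjugate, which is again in \<open>M\<close> and so is invisible to \<open>lam\<close>. Hence
    \<open>l1\<close> is invariant under \<open>M\<close> too, and likewise
    \<open>l2\<close>.\<close>
  have e_conj: "lam (\<alpha> e (\<alpha> x v)) = lam (\<alpha> e v)" if x: "x \<in> M" and v: "v \<in> carrier V" for x v
  proof -
    have ex: "e \<otimes> x \<otimes> inv e \<in> M" by (rule maximal_conj_closed[OF Msub(1) ZM e(1) x])
    have "\<alpha> e (\<alpha> x v) = \<alpha> (e \<otimes> x \<otimes> inv e \<otimes> e) v"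
      using e x v Mc by (simp add: m_assoc action_comp)
    also have "\<dots> = \<alpha> (e \<otimes> x \<otimes> inv e) (\<alpha> e v)"
      using e x v Mc by (intro action_comp) auto
    finally show ?thesis using lam_inv[OF ex] e v by (simp add: action_closed)
  qed
  have ee_conj: "lam (\<alpha> e (\<alpha> e (\<alpha> x v))) = lam (\<alpha> e (\<alpha> e v))" if x: "x \<in> M" and v: "v \<in> carrier V" for x v
  proof -
    have ex: "e \<otimes> x \<otimes> inv e \<in> M" by (rule maximal_conj_closed[OF Msub(1) ZM e(1) x])
    have "\<alpha> e (\<alpha> x v) = \<alpha> (e \<otimes> x \<otimes> inv e \<otimes> e) v"
      using e x v Mc by (simp add: m_assoc action_comp)
    also have "\<dots> = \<alpha> (e \<otimes> x \<otimes> inv e) (\<alpha> e v)"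
      using e x v Mc by (intro action_comp) auto
    finally show ?thesis using e_conj[OF ex] e v by (simp add: action_closed)
  qed
  have l_M: "lam (\<alpha> x v) = lam v" "l1 (\<alpha> x v) = l1 v" "l2 (\<alpha> x v) = l2 v"
    if "x \<in> M" "v \<in> carrier V" for x v
    using that lam_inv e_conj ee_conj by (auto simp: l1_def l2_def)
  \<comment> \<open>Since \<open>e\<close> has cube one, it shifts the three characters
    cyclically.\<close>
  have l_e: "lam (\<alpha> e v) = l1 v" "l1 (\<alpha> e v) = l2 v" "l2 (\<alpha> e v) = lam v" if v: "v \<in> carrier V" for v
  proof -
    have "\<alpha> e (\<alpha> e (\<alpha> e v)) = v"
      using cube[OF e(1)] e v by (metis action_comp action_one action_closed m_closed)
    thus "l2 (\<alpha> e v) = lam v" by (simp add: l2_def)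
  qed (simp_all add: l1_def l2_def)

  have D_mult: "D (v \<otimes>\<^bsub>V\<^esub> v') = D v * D v'" if vv: "v \<in> carrier V" "v' \<in> carrier V" for v v'
  proof -
    have "a (v \<otimes>\<^bsub>V\<^esub> v') = a v * a v' + b v * c v' + c v * b v'"
      unfolding a_def b_def c_def l_mult[OF vv] lam_mult[OF vv] by (rule fourier_convolution_3[OF w_sum])
    moreover have "b (v \<otimes>\<^bsub>V\<^esub> v') = a v * b v' + b v * a v' + c v * c v'"
      unfolding a_def b_def c_def l_mult[OF vv] lam_mult[OF vv] by (rule fourier_convolution_3[OF w_sum])
    moreover have "c (v \<otimes>\<^bsub>V\<^esub> v') = a v * c v' + b v * b v' + c v * a v'"
      unfolding a_def b_def c_def l_mult[OF vv] lam_mult[OF vv] by (rule fourier_convolution_3[OF w_sum])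
    ultimately show ?thesis unfolding D_def quad_mat_mult[OF A A3] by simp
  qed
  have D_one: "D v = 1\<^sub>m n" if "lam v = 1" "l1 v = 1" "l2 v = 1" for v
  proof -
    have "a v = 1" "b v = 0" "c v = 0"
      using that w_sum by (simp_all add: a_def b_def c_def algebra_simps)
    thus ?thesis by (simp add: D_def quad_mat_one)
  qed
  have l_one: "lam \<one>\<^bsub>V\<^esub> = 1" "l1 \<one>\<^bsub>V\<^esub> = 1" "l2 \<one>\<^bsub>V\<^esub> = 1"
  proof -
    show 1: "lam \<one>\<^bsub>V\<^esub> = 1" using lam_mult[of "\<one>\<^bsub>V\<^esub>" "\<one>\<^bsub>V\<^esub>"] lam7[of "\<one>\<^bsub>V\<^esub>"] by auto
    show "l1 \<one>\<^bsub>V\<^esub> = 1" "l2 \<one>\<^bsub>V\<^esub> = 1" using e 1 by (auto simp: l1_def l2_def action_by_one)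
  qed

  \<comment> \<open>The elements for which \<open>\<sigma>\<close> and \<open>D\<close> satisfy the
    semidirect product relation form a subgroup. It contains \<open>M\<close> and an element
    \<open>e\<close> outside, so maximality of \<open>M\<close> makes it everything and only these
    two cases need computation.\<close>
  define H where "H = {x \<in> carrier E. \<forall>v \<in> carrier V. \<sigma> x * D v = D (\<alpha> x v) * \<sigma> x}"
  have H_mult: "x \<otimes> y \<in> H" if "x \<in> H" "y \<in> H" for x y
  proof -
    have xy: "x \<in> carrier E" "y \<in> carrier E" using that by (auto simp: H_def)
    have "\<sigma> (x \<otimes> y) * D v = D (\<alpha> (x \<otimes> y) v) * \<sigma> (x \<otimes> y)" if v: "v \<in> carrier V" for v
    proof -
      have "\<sigma> (x \<otimes> y) * D v = \<sigma> x * (\<sigma> y * D v)"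
        using xy by (simp add: mult assoc_mult_mat[of _ n n _ n _ n])
      also have "\<dots> = \<sigma> x * D (\<alpha> y v) * \<sigma> y"
        using \<open>y \<in> H\<close> xy v by (simp add: H_def assoc_mult_mat[of _ n n _ n _ n])
      also have "\<dots> = D (\<alpha> x (\<alpha> y v)) * \<sigma> x * \<sigma> y"
        using \<open>x \<in> H\<close> xy v by (simp add: H_def action_closed)
      finally show ?thesis using xy v by (simp add: mult action_comp assoc_mult_mat[of _ n n _ n _ n])
    qed
    thus ?thesis using xy by (simp add: H_def)
  qed
  have M_H: "M \<subseteq> H"
  proof
    fix x assume x: "x \<in> M"
    have "x \<otimes> m = m \<otimes> x" using x cent by blast
    hence "\<sigma> x * A = A * \<sigma> x"
      unfolding A_def using Mc[OF x] mc mult[of x m] mult[of m x] by simp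
    hence "\<sigma> x * D v = D v * \<sigma> x" for v
      unfolding D_def by (intro quad_mat_commute A carr[OF Mc[OF x]])
    moreover have "D (\<alpha> x v) = D v" if "v \<in> carrier V" for v
      using l_M[OF x that] by (simp add: D_def a_def b_def c_def)
    ultimately show "x \<in> H" using Mc[OF x] by (simp add: H_def)
  qed
  have e_H: "e \<in> H"
  proof -
    have "\<sigma> e * D v = D (\<alpha> e v) * \<sigma> e" if v: "v \<in> carrier V" for v
    proof -
      have w3: "w * (w * w) = 1" using w(2) by (simp add: power3_eq_cube mult.assoc)
      have w3': "w * (w * (w * t)) = t" for t using w3 by (metis mult.assoc mult_1)
      \<comment> \<open>A cyclic shift of the values multiplies the Fourier coefficients by 1,
        \<open>w\<close>, \<open>w ^ 2\<close>, which are exactly the weights in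
        \<open>quad_mat_conj\<close>.\<close>
      have "a (\<alpha> e v) = a v" by (simp add: a_def l_e[OF v])
      moreover have "b (\<alpha> e v) = w * b v"
        by (simp add: b_def l_e[OF v] algebra_simps power2_eq_square w3 w3')
      moreover have "c (\<alpha> e v) = w ^ 2 * c v"
        by (simp add: c_def l_e[OF v] algebra_simps power2_eq_square w3 w3')
      ultimately show ?thesis
        unfolding D_def using quad_mat_conj[OF A carr[OF e(1)] BA] by simp
    qed
    thus ?thesis using e by (simp add: H_def)
  qed
  have "subgroup H E"
  proof (rule subgroupI)
    \<comment> \<open>Inverses are squares here, so closure under products suffices.\<close>
    show "inv x \<in> H" if "x \<in> H" for x
      using H_mult[OF that that] that inv_eq_square by (simp add: H_def)
  qed (use H_mult e_H in \<open>auto simp: H_def\<close>)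
  hence "H = carrier E" using M(1) M_H e_H e(2) by (auto simp: maximal_subgroup_def)
  hence equiv: "\<sigma> x * D v = D (\<alpha> x v) * \<sigma> x" if "x \<in> carrier E" "v \<in> carrier V" for x v
    using that by (auto simp: H_def)

  define \<rho> where "\<rho> = (\<lambda>(v, x). D v * \<sigma> x)"
  have "representation G n \<rho>"
    unfolding representation_def
  proof (intro conjI ballI)
    show "\<rho> \<in> carrier G \<rightarrow> carrier_mat n n" by (auto simp: \<rho>_def carrier_semidirect)
    show "\<rho> \<one>\<^bsub>G\<^esub> = 1\<^sub>m n" using D_one[OF l_one] one by (simp add: \<rho>_def one_semidirect)
    fix g h assume "g \<in> carrier G" "h \<in> carrier G"
    then obtain v x v' y where gh: "g = (v, x)" "h = (v', y)" "v \<in> carrier V" "v' \<in> carrier V"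
      "x \<in> carrier E" "y \<in> carrier E" by (auto simp: carrier_semidirect)
    have "\<rho> (g \<otimes>\<^bsub>G\<^esub> h) = D v * (D (\<alpha> x v') * \<sigma> x) * \<sigma> y"
      using gh by (simp add: \<rho>_def mult_semidirect D_mult action_closed mult assoc_mult_mat[of _ n n _ n _ n])
    also have "D (\<alpha> x v') * \<sigma> x = \<sigma> x * D v'" using gh by (simp add: equiv)
    finally show "\<rho> (g \<otimes>\<^bsub>G\<^esub> h) = \<rho> g * \<rho> h"
      using gh by (simp add: \<rho>_def assoc_mult_mat[of _ n n _ n _ n])
  qed
  moreover have "W = {0\<^sub>v n} \<or> W = carrier_vec n"
    if W: "subspace class_ring W (module_vec TYPE(complex) n)"
      "\<forall>g \<in> carrier G. \<forall>u \<in> W. \<rho> g *\<^sub>v u \<in> W" for W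
  proof -
    have "\<sigma> x *\<^sub>v u \<in> W" if x: "x \<in> carrier E" and u: "u \<in> W" for x u
    proof -
      have "\<rho> (\<one>\<^bsub>V\<^esub>, x) *\<^sub>v u \<in> W" using W(2) x u by (auto simp: carrier_semidirect)
      moreover have "\<rho> (\<one>\<^bsub>V\<^esub>, x) = \<sigma> x" using D_one[OF l_one] x by (simp add: \<rho>_def left_mult_one_mat[of _ n n])
      ultimately show ?thesis by simp
    qed
    thus ?thesis using irr W(1) by (auto simp: irreducible_representation_def)
  qed
  ultimately have "irreducible_representation G n \<rho>"
    using n0 by (auto simp: irreducible_representation_def)

  moreover have "mtrace n (\<rho> (v, x)) = mtrace n (\<sigma> x)" if vx: "(v, x) \<in> pi_elements {3} G" for v x
  proof (cases "x \<in> M")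
    case True
    interpret SG: group G by (rule group_semidirect)
    let ?k = "group.ord G (v, x)"
    have g: "(v, x) \<in> carrier G" and k: "pi_number {3} ?k" using vx by (auto simp: pi_elements_def)
    have v: "v \<in> carrier V" using g by (simp add: carrier_semidirect)
    \<comment> \<open>Because \<open>M\<close> fixes all three characters, their values at the
      \<open>V\<close>-component of a power are the powers of their values at \<open>v\<close>.
      Evaluated at the order of \<open>(v, x)\<close>, this makes each value a root of unity of
      3-power order.\<close>
    have pow: "\<exists>v' x'. (v, x) [^]\<^bsub>G\<^esub> k = (v', x') \<and> v' \<in> carrier V \<and> x' \<in> M \<and>
        lam v' = lam v ^ k \<and> l1 v' = l1 v ^ k \<and> l2 v' = l2 v ^ k" for k :: nat
    proof (induction k)
      case 0
      show ?case using l_one subgroup.one_closed[OF Msub(1)] by (simp add: one_semidirect)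
    next
      case (Suc k)
      then obtain v' x' where IH: "(v, x) [^]\<^bsub>G\<^esub> k = (v', x')" "v' \<in> carrier V" "x' \<in> M"
        "lam v' = lam v ^ k" "l1 v' = l1 v ^ k" "l2 v' = l2 v ^ k" by blast
      have "(v, x) [^]\<^bsub>G\<^esub> Suc k = (v' \<otimes>\<^bsub>V\<^esub> \<alpha> x' v, x' \<otimes> x)"
        by (simp add: IH(1) mult_semidirect)
      moreover have "\<alpha> x' v \<in> carrier V" using Mc[OF IH(3)] v by (rule action_closed)
      moreover have "x' \<otimes> x \<in> M" using IH(3) True Msub(1) by (simp add: subgroup.m_closed)
      ultimately show ?case using IH v
        by (auto simp: l_mult lam_mult l_M)
    qed
    have "(v, x) [^]\<^bsub>G\<^esub> ?k = \<one>\<^bsub>G\<^esub>" using g by simp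
    hence pk: "lam v ^ ?k = 1" "l1 v ^ ?k = 1" "l2 v ^ ?k = 1"
      using pow[of ?k] l_one by (auto simp: one_semidirect)
    have "coprime ?k 7" by (rule coprime_pi_number[OF k]) auto
    moreover have "0 < ?k" using k by (simp add: pi_number_def)
    ultimately have "lam v = 1" "l1 v = 1" "l2 v = 1"
      using pk lam7[OF v] l7[OF v] power_coprime_eq_1 by metis+
    hence "D v = 1\<^sub>m n" by (rule D_one)
    thus ?thesis using Mc[OF True] by (simp add: \<rho>_def left_mult_one_mat[of _ n n])
  next
    case False
    have v: "v \<in> carrier V" and x: "x \<in> carrier E" using vx by (auto simp: pi_elements_def carrier_semidirect)
    have "x \<otimes> m \<noteq> m \<otimes> x" using False x cent by blast
    then obtain u where u: "u \<noteq> 1" "\<sigma> x * A = u \<cdot>\<^sub>m (A * \<sigma> x)"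
      unfolding A_def using commutation_scalar[OF irr n x mc] by metis
    \<comment> \<open>As a polynomial in \<open>A\<close>, \<open>D v\<close> commutes with
      \<open>A\<close>; hence \<open>D v * \<sigma> x\<close> satisfies the same twisted commutation
      with \<open>A\<close> as \<open>\<sigma> x\<close>, and both traces are zero.\<close>
    have AD: "A * D v = D v * A"
      unfolding D_def by (rule quad_mat_commute[OF A A refl])
    have "D v * \<sigma> x * A = D v * (u \<cdot>\<^sub>m (A * \<sigma> x))"
      using x by (simp add: u(2)[symmetric] assoc_mult_mat[of _ n n _ n _ n])
    also have "\<dots> = u \<cdot>\<^sub>m (D v * A * \<sigma> x)"
      using x by (simp add: mult_smult_distrib[where nr = n and n = n and nc = n] assoc_mult_mat[of _ n n _ n _ n])
    also have "\<dots> = u \<cdot>\<^sub>m (A * (D v * \<sigma> x))"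
      unfolding AD[symmetric] using x by (simp add: assoc_mult_mat[of _ n n _ n _ n])
    finally have "D v * \<sigma> x * A = u \<cdot>\<^sub>m (A * (D v * \<sigma> x))" .
    hence "mtrace n (D v * \<sigma> x) = 0"
      using x u(1) by (intro mtrace_eq_zero[OF _ A A3]) auto
    moreover have "mtrace n (\<sigma> x) = 0"
      using x u by (intro mtrace_eq_zero[OF _ A A3 u(2)]) auto
    ultimately show ?thesis by (simp add: \<rho>_def)
  qed

  moreover have "mtrace n (\<rho> (v, \<one>)) \<noteq> of_nat n" if v: "v \<in> carrier V" "lam v \<noteq> 1" for v
  proof
    assume eq: "mtrace n (\<rho> (v, \<one>)) = of_nat n"
    \<comment> \<open>Here \<open>\<sigma> e\<close> is the conjugating matrix: \<open>A\<close> and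
      \<open>A * A\<close> commute with it up to \<open>w ^ 2\<close> and \<open>w\<close>, neither
      of which is 1. Both have trace zero, so only the constant coefficient \<open>a v\<close>
      contributes to the trace of \<open>D v\<close>.\<close>
    have AB: "A * \<sigma> e = w ^ 2 \<cdot>\<^sub>m (\<sigma> e * A)"
      using w(2) by (simp add: BA smult_smult_mat one_smult_mat power2_eq_square power3_eq_cube)
    have tA: "mtrace n A = 0"
      using w by (intro mtrace_eq_zero[OF A carr[OF e(1)] cube_mat[OF e(1)] AB])
        (auto simp: power2_eq_square power3_eq_cube)
    have "A * A * \<sigma> e = A * (w ^ 2 \<cdot>\<^sub>m (\<sigma> e * A))"
      using e by (simp add: AB[symmetric] assoc_mult_mat[of _ n n _ n _ n])
    also have "\<dots> = w ^ 2 \<cdot>\<^sub>m (A * \<sigma> e * A)"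
      using e by (simp add: mult_smult_distrib[where nr = n and n = n and nc = n] assoc_mult_mat[of _ n n _ n _ n])
    also have "\<dots> = (w ^ 2 * w ^ 2) \<cdot>\<^sub>m (\<sigma> e * (A * A))"
      unfolding AB using e by (simp add: mult_smult_assoc_mat[where nr = n and n = n and nc = n]
          smult_smult_mat assoc_mult_mat[of _ n n _ n _ n])
    also have "w ^ 2 * w ^ 2 = w" using w(2) by (simp add: power2_eq_square power3_eq_cube mult.assoc)
    finally have "A * A * \<sigma> e = w \<cdot>\<^sub>m (\<sigma> e * (A * A))" .
    hence tAA: "mtrace n (A * A) = 0"
      using w e by (intro mtrace_eq_zero[OF _ carr[OF e(1)] cube_mat[OF e(1)]]) auto
    have "mtrace n (\<rho> (v, \<one>)) = mtrace n (D v)" by (simp add: \<rho>_def one right_mult_one_mat[of _ n n])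
    also have "\<dots> = a v * of_nat n"
      by (simp add: D_def quad_mat_def mtrace_add[of _ n] mtrace_smult[of _ n] mtrace_one tA tAA)
    finally have "a v = 1" using eq n0 by simp
    hence "lam v + l1 v + l2 v = 3" by (simp add: a_def)
    moreover have "norm (lam v) = 1" "norm (l1 v) = 1" "norm (l2 v) = 1"
      using lam7[OF v(1)] l7[OF v(1)] norm_root_of_unity[of _ 6] by auto
    ultimately show False using v(2) sum_three_unit_eq_3 by blast
  qed
  ultimately show ?thesis by (rule that)
qed

section \<open>Linear characters and special characters\<close>

lemma linear_Irr_mult:
  assumes \<gamma>: "\<gamma> \<in> Irr H" "\<gamma> \<one>\<^bsub>H\<^esub> = 1" and one: "\<one>\<^bsub>H\<^esub> \<in> carrier H"
    and xy: "x \<in> carrier H" "y \<in> carrier H" "x \<otimes>\<^bsub>H\<^esub> y \<in> carrier H"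
  shows "\<gamma> (x \<otimes>\<^bsub>H\<^esub> y) = \<gamma> x * \<gamma> y"
proof -
  obtain n \<rho> where rep: "representation H n \<rho>" and ch: "\<gamma> = character_of H n \<rho>"
    using \<gamma>(1) by (auto simp: Irr_def irreducible_representation_def)
  have "of_nat n = (1 :: complex)"
    using \<gamma>(2) rep one by (simp add: ch character_of_def representation_def)
  hence n: "n = 1" by simp
  have "\<gamma> z = \<rho> z $$ (0, 0)" if "z \<in> carrier H" for z
    using that by (simp add: ch character_of_def n)
  moreover have "\<rho> (x \<otimes>\<^bsub>H\<^esub> y) = \<rho> x * \<rho> y" "\<rho> x \<in> carrier_mat 1 1" "\<rho> y \<in> carrier_mat 1 1"
    using rep xy n by (auto simp: representation_def)
  ultimately show ?thesis using xy by (simp add: scalar_prod_def)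
qed

lemma linear_in_Irr:
  fixes lam :: "'a \<Rightarrow> complex"
  assumes ext: "lam \<in> extensional (carrier H)" and one: "lam \<one>\<^bsub>H\<^esub> = 1"
    and mult: "\<And>x y. x \<in> carrier H \<Longrightarrow> y \<in> carrier H \<Longrightarrow> lam (x \<otimes>\<^bsub>H\<^esub> y) = lam x * lam y"
  shows "lam \<in> Irr H"
proof -
  define \<rho> where "\<rho> = (\<lambda>x. mat 1 1 (\<lambda>_. lam x))"
  have "representation H 1 \<rho>"
    unfolding representation_def
  proof (intro conjI ballI)
    show "\<rho> \<one>\<^bsub>H\<^esub> = 1\<^sub>m 1" by (intro eq_matI) (auto simp: \<rho>_def one)
    show "\<rho> (x \<otimes>\<^bsub>H\<^esub> y) = \<rho> x * \<rho> y" if "x \<in> carrier H" "y \<in> carrier H" for x y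
      using that by (intro eq_matI) (auto simp: \<rho>_def mult scalar_prod_def)
  qed (auto simp: \<rho>_def)
  moreover have "W = {0\<^sub>v 1} \<or> W = carrier_vec 1"
    if W: "subspace class_ring W (module_vec TYPE(complex) 1)" for W
  proof (rule disjCI)
    assume ne: "W \<noteq> carrier_vec 1"
    have sub: "W \<subseteq> carrier_vec 1" and zero: "0\<^sub>v 1 \<in> W"
      and smult: "\<And>c v. v \<in> W \<Longrightarrow> c \<cdot>\<^sub>v v \<in> W"
      using subspace.submod[OF W] by (auto simp: submodule_def module_vec_simps class_ring_simps)
    have "v = 0\<^sub>v 1" if v: "v \<in> W" for v
    proof (rule ccontr)
      assume "v \<noteq> 0\<^sub>v 1"
      hence v0: "v $ 0 \<noteq> 0" using v sub by (auto simp: vec_eq_iff)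
      have "u \<in> W" if u: "u \<in> carrier_vec 1" for u
      proof -
        have "u = (u $ 0 / v $ 0) \<cdot>\<^sub>v v" using u v sub v0 by (intro eq_vecI) auto
        thus ?thesis using smult[OF v] by metis
      qed
      thus False using ne sub by blast
    qed
    thus "W = {0\<^sub>v 1}" using zero by blast
  qed
  ultimately have "irreducible_representation H 1 \<rho>"
    by (simp add: irreducible_representation_def)
  moreover have "lam = character_of H 1 \<rho>"
    using ext by (auto simp: character_of_def \<rho>_def extensional_def restrict_def)
  ultimately show ?thesis unfolding Irr_def by blast
qed

text \<open>Whatever representation \<open>SOME\<close> selects, its character is
  \<open>lam\<close>, so it has size 1 and its determinant is its only entry.\<close>

lemma det_char_linear:
  assumes lam: "lam \<in> Irr H" "lam \<one>\<^bsub>H\<^esub> = 1" and one: "\<one>\<^bsub>H\<^esub> \<in> carrier H" and g: "g \<in> carrier H"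
  shows "det_char H lam g = lam g"
proof -
  let ?P = "\<lambda>\<rho>. \<exists>n. representation H n \<rho> \<and> character_of H n \<rho> = lam"
  have "\<exists>\<rho>. ?P \<rho>" using lam(1) by (auto simp: Irr_def irreducible_representation_def)
  hence "?P (SOME \<rho>. ?P \<rho>)" by (rule someI_ex)
  then obtain n \<rho> where \<rho>: "\<rho> = (SOME \<rho>. ?P \<rho>)" "representation H n \<rho>" "character_of H n \<rho> = lam"
    by blast
  have "of_nat n = (1 :: complex)"
    using lam(2) \<rho>(2) one by (simp add: \<rho>(3)[symmetric] character_of_def representation_def)
  hence n: "n = 1" by simp
  have "\<rho> g \<in> carrier_mat 1 1" using \<rho>(2) g n by (auto simp: representation_def)
  hence "det (\<rho> g) = \<rho> g $$ (0, 0)" by (rule det_single)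
  also have "\<dots> = lam g" using g by (simp add: \<rho>(3)[symmetric] character_of_def n)
  finally show ?thesis using g by (simp add: det_char_def \<rho>(1))
qed

text \<open>By \<open>det_char_linear\<close> the determinantal order is an exponent for the values
  of \<open>lam\<close>. It is prime to \<open>q\<close>, which is also one. The number
  \<open>q\<close> also shows that the \<open>LEAST\<close> in \<open>det_order\<close> is
  attained.\<close>

lemma linear_trivial_if_coprime_orders:
  assumes lam: "lam \<in> Irr H" "lam \<one>\<^bsub>H\<^esub> = 1" and one: "\<one>\<^bsub>H\<^esub> \<in> carrier H"
    and pow: "\<And>g. g \<in> carrier H \<Longrightarrow> lam g ^ q = 1"
    and q: "Factorial_Ring.prime q" "q \<noteq> p" and pi: "pi_number {p} (det_order H lam)"
    and g: "g \<in> carrier H"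
  shows "lam g = 1"
proof -
  let ?Q = "\<lambda>k. 0 < k \<and> (\<forall>g \<in> carrier H. det_char H lam g ^ k = 1)"
  have "?Q q" using pow det_char_linear[OF lam one] prime_gt_0_nat[OF q(1)] by auto
  hence "?Q (det_order H lam)" unfolding det_order_def by (rule LeastI)
  hence "0 < det_order H lam" "lam g ^ det_order H lam = 1"
    using det_char_linear[OF lam one] g by auto
  thus ?thesis using power_coprime_eq_1[OF _ pow[OF g] coprime_pi_number[OF pi q]] by blast
qed

text \<open>Fourier inversion on a cyclic group of order \<open>p\<close> whose characters are the powers of \<open>l\<close>.\<close>

lemma constant_if_fourier_coeffs_vanish:
  fixes f l :: "'a \<Rightarrow> complex"
  assumes fin: "finite S" and p: "0 < p" and inj: "inj_on l S" and pow: "\<And>x. x \<in> S \<Longrightarrow> l x ^ p = 1"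
    and van: "\<And>j. 0 < j \<Longrightarrow> j < p \<Longrightarrow> (\<Sum>x\<in>S. f x * cnj (l x ^ j)) = 0"
    and y: "y \<in> S"
  shows "of_nat p * f y = (\<Sum>x\<in>S. f x)"
proof -
  have nl: "norm (l x) = 1" if "x \<in> S" for x
    using pow[OF that] norm_root_of_unity[of "l x" "p - 1"] p by simp
  \<comment> \<open>Orthogonality: on the unit circle conjugates are inverses, so the ratio
    \<open>?r\<close> is a \<open>p\<close>-th root of unity, equal to 1 only for
    \<open>x = y\<close> by injectivity of \<open>l\<close>; otherwise the geometric sum
    vanishes.\<close>
  have delta: "(\<Sum>j<p. cnj (l x ^ j) * l y ^ j) = (if x = y then of_nat p else 0)" if x: "x \<in> S" for x
  proof -
    let ?r = "cnj (l x) * l y"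
    have xx: "cnj (l x) * l x = 1"
      using nl[OF x] complex_norm_square[of "l x"] by (simp add: mult.commute)
    have rp: "?r ^ p = 1"
      using pow[OF x] pow[OF y] by (simp add: power_mult_distrib flip: complex_cnj_power)
    have sum: "(\<Sum>j<p. cnj (l x ^ j) * l y ^ j) = (\<Sum>j<p. ?r ^ j)"
      by (simp add: power_mult_distrib)
    show ?thesis
    proof (cases "x = y")
      case True
      thus ?thesis using sum xx by simp
    next
      case False
      have "?r \<noteq> 1"
      proof
        assume "?r = 1"
        hence "cnj (l x) * l y = cnj (l x) * l x" using xx by simp
        moreover have "cnj (l x) \<noteq> 0" using xx by auto
        ultimately have "l x = l y" by simp
        thus False using inj x y False by (auto dest: inj_onD)
      qed
      thus ?thesis using sum geometric_sum[of ?r p] rp False by simp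
    qed
  qed
  have "of_nat p * f y = (\<Sum>x\<in>S. if x = y then of_nat p * f x else 0)"
    using fin y by simp
  also have "\<dots> = (\<Sum>x\<in>S. f x * (\<Sum>j<p. cnj (l x ^ j) * l y ^ j))"
  proof (rule sum.cong)
    fix x assume "x \<in> S"
    thus "(if x = y then of_nat p * f x else 0) = f x * (\<Sum>j<p. cnj (l x ^ j) * l y ^ j)"
      unfolding delta[OF \<open>x \<in> S\<close>] by simp
  qed simp
  also have "\<dots> = (\<Sum>x\<in>S. \<Sum>j<p. f x * cnj (l x ^ j) * l y ^ j)"
    by (simp only: sum_distrib_left mult.assoc)
  also have "\<dots> = (\<Sum>j<p. (\<Sum>x\<in>S. f x * cnj (l x ^ j)) * l y ^ j)"
    by (subst sum.swap) (simp only: sum_distrib_right)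
  also have "\<dots> = (\<Sum>j<p. if j = 0 then \<Sum>x\<in>S. f x else 0)"
    using van by (intro sum.cong) auto
  also have "\<dots> = (\<Sum>x\<in>S. f x)" using p by simp
  finally show ?thesis .
qed

text \<open>Any nonidentity element generates the group; \<open>l\<close> is the discrete logarithm
  to that base followed by \<open>k \<mapsto> cis (2 * pi * k / p)\<close>.\<close>

lemma (in group) faithful_character_prime_order:
  assumes p: "Factorial_Ring.prime p" "Coset.order G = p"
  shows "\<exists>l :: 'a \<Rightarrow> complex. inj_on l (carrier G) \<and> (\<forall>x \<in> carrier G. l x ^ p = 1) \<and>
    (\<forall>x \<in> carrier G. \<forall>y \<in> carrier G. l (x \<otimes> y) = l x * l y)"
proof -
  have p1: "p > 1" using p prime_gt_1_nat by blast
  have fin: "finite (carrier G)" using p1 p(2) order_gt_0_iff_finite by simp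
  have "carrier G \<noteq> {\<one>}" using p1 p(2) by (auto simp: Coset.order_def)
  then obtain g where g: "g \<in> carrier G" "g \<noteq> \<one>" using one_closed by blast
  have "ord g dvd p" using ord_dvd_group_order[OF g(1)] p(2) by simp
  hence ordg: "ord g = p" using p(1) g ord_eq_1 by (auto simp: prime_nat_iff)
  have gp: "g [^] p = \<one>" using pow_ord_eq_1[OF g(1)] ordg by simp
  have "{0..ord g - 1} = {..<p}" using ordg p1 by auto
  hence inj: "inj_on (\<lambda>k. g [^] k) {..<p}" using ord_inj[OF g(1)] by simp
  moreover have "(\<lambda>k. g [^] k) ` {..<p} = carrier G"
    using fin g(1) inj p(2) by (intro card_subset_eq) (auto simp: card_image Coset.order_def)
  ultimately have bij: "bij_betw (\<lambda>k. g [^] k) {..<p} (carrier G)" by (simp add: bij_betw_def)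
  define dlog where "dlog = inv_into {..<p} (\<lambda>k. g [^] k)"
  have dlog: "dlog x < p" "g [^] dlog x = x" if "x \<in> carrier G" for x
    using bij that inv_into_into[of x "\<lambda>k. g [^] k" "{..<p}"] f_inv_into_f[of x "\<lambda>k. g [^] k" "{..<p}"]
    by (auto simp: dlog_def bij_betw_def)
  have dlog_pow: "dlog (g [^] k) = k" if "k < p" for k
    using that inj by (simp add: dlog_def)
  have pow_mod: "g [^] (k mod p) = g [^] k" for k
  proof -
    have "g [^] k = g [^] (p * (k div p) + k mod p)" by simp
    also have "\<dots> = (g [^] p) [^] (k div p) \<otimes> g [^] (k mod p)"
      using g(1) by (simp only: nat_pow_mult nat_pow_pow)
    finally show ?thesis using g(1) gp by simp
  qed
  define z where "z = (\<lambda>k. cis (2 * pi * real k / real p))"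
  have z_bij: "bij_betw z {..<p} {z. z ^ p = 1}"
    using bij_betw_roots_unity[of p] p1 unfolding z_def by simp
  hence z_inj: "inj_on z {..<p}" by (simp add: bij_betw_def)
  have z_p: "z k ^ p = 1" if "k < p" for k
    using bij_betwE[OF z_bij] that by blast
  have z_pow: "z k = z 1 ^ k" for k by (simp add: z_def DeMoivre mult_ac)
  have z_mod: "z (k mod p) = z k" for k
  proof -
    have "z 1 ^ k = z 1 ^ (p * (k div p) + k mod p)" by simp
    also have "\<dots> = z 1 ^ (k mod p)" using z_p[OF p1] by (simp only: power_add power_mult) simp
    finally show ?thesis using z_pow[of k] z_pow[of "k mod p"] by simp
  qed
  have z_add: "z (i + j) = z i * z j" for i j
    using z_pow[of i] z_pow[of j] z_pow[of "i + j"] by (simp add: power_add)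
  have "inj_on (\<lambda>x. z (dlog x)) (carrier G)"
  proof (rule inj_onI)
    fix x y assume xy: "x \<in> carrier G" "y \<in> carrier G" "z (dlog x) = z (dlog y)"
    hence "dlog x = dlog y" using z_inj dlog(1)
      by (meson inj_onD lessThan_iff)
    thus "x = y" using dlog(2) xy by metis
  qed
  moreover have "z (dlog x) ^ p = 1" if "x \<in> carrier G" for x
    using z_p dlog that by blast
  moreover have "z (dlog (x \<otimes> y)) = z (dlog x) * z (dlog y)"
    if xy: "x \<in> carrier G" "y \<in> carrier G" for x y
  proof -
    have "x \<otimes> y = g [^] (dlog x + dlog y)"
      using xy g dlog by (simp add: nat_pow_mult[symmetric])
    also have "\<dots> = g [^] ((dlog x + dlog y) mod p)" by (rule pow_mod[symmetric])
    finally have "dlog (x \<otimes> y) = (dlog x + dlog y) mod p"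
      using p1 by (simp add: dlog_pow)
    thus ?thesis by (simp add: z_mod z_add)
  qed
  ultimately show ?thesis by (intro exI[of _ "\<lambda>x. z (dlog x)"]) auto
qed

text \<open>A nontrivial linear constituent of the restriction to \<open>W\<close> would have order
  \<open>q\<close>, while specialness demands that its order be a power of \<open>p\<close>. So all
  Fourier coefficients of \<open>\<delta>\<close> on \<open>W\<close> except the trivial one vanish,
  and \<open>\<delta>\<close> is constant there.\<close>

lemma (in group) pi_special_constant_on_normal_prime_subgroup:
  assumes q: "Factorial_Ring.prime q" "q \<noteq> p" and W: "W \<lhd> G" "card W = q"
    and sp: "pi_special {p} G \<delta>" and w: "w \<in> W"
  shows "\<delta> w = \<delta> \<one>"
proof -
  let ?W = "G\<lparr>carrier := W\<rparr>"
  have sub: "subgroup W G" using W(1) by (rule normal_imp_subgroup)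
  interpret W: group ?W using sub by (rule subgroup_imp_group)
  have q1: "q > 1" using q prime_gt_1_nat by blast
  have fin: "finite W" using W(2) q1 card_gt_0_iff[of W] by simp
  have ord: "Coset.order ?W = q" using W(2) by (simp add: Coset.order_def)
  obtain l :: "'a \<Rightarrow> complex" where l: "inj_on l W" "\<And>x. x \<in> W \<Longrightarrow> l x ^ q = 1"
    "\<And>x y. x \<in> W \<Longrightarrow> y \<in> W \<Longrightarrow> l (x \<otimes> y) = l x * l y"
    using W.faithful_character_prime_order[OF q(1) ord] by auto
  have one: "\<one> \<in> W" using sub by (rule subgroup.one_closed)
  have l1: "l \<one> = 1" using l(2)[OF one] l(3)[OF one one] q1 by (auto simp: power_0_left)
  have "W \<noteq> {\<one>}" using W(2) q1 by auto
  then obtain v where v: "v \<in> W" "v \<noteq> \<one>" using one by blast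
  have lv: "l v \<noteq> 1" using l(1) v one l1 by (metis inj_onD)
  have S: "subnormal G W"
    by (rule subnormal_step[OF subnormal_carrier]) (use W(1) in simp)
  have van: "(\<Sum>x\<in>W. \<delta> x * cnj (l x ^ j)) = 0" if j: "0 < j" "j < q" for j
  proof (rule ccontr)
    assume ne: "(\<Sum>x\<in>W. \<delta> x * cnj (l x ^ j)) \<noteq> 0"
    define lam where "lam = (\<lambda>x\<in>W. l x ^ j)"
    have Irr: "lam \<in> Irr ?W"
      using one l l1 sub by (intro linear_in_Irr) (auto simp: lam_def power_mult_distrib subgroup.m_closed)
    \<comment> \<open>Up to the factor \<open>q\<close>, the Fourier coefficient is the multiplicity
      of the linear character \<open>l ^ j\<close>, so a nonzero one yields a constituent.\<close>
    have "inner_char ?W (restrict \<delta> W) lam = (\<Sum>x\<in>W. \<delta> x * cnj (l x ^ j)) / of_nat q"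
      by (auto simp: inner_char_def lam_def Coset.order_def W(2) intro!: sum.cong)
    hence "lam \<in> irr_constituents ?W (restrict \<delta> W)"
      using ne q1 Irr by (simp add: irr_constituents_def)
    hence pi: "pi_number {p} (det_order ?W lam)" using sp S by (auto simp: pi_special_def)
    have "lam v = 1"
    proof (rule linear_trivial_if_coprime_orders[OF Irr _ _ _ q pi])
      show "lam g ^ q = 1" if "g \<in> carrier ?W" for g
        using that l(2) by (simp add: lam_def) (metis power_mult mult.commute power_one)
    qed (use one l1 v in \<open>auto simp: lam_def\<close>)
    hence "l v ^ j = 1" using v by (simp add: lam_def)
    moreover have "coprime j q"
      using j q(1) by (metis coprime_commute nat_dvd_not_less prime_imp_coprime)
    ultimately have "l v = 1" using power_coprime_eq_1[OF _ l(2)[OF v(1)]] j by blast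
    thus False using lv by simp
  qed
  have q0: "0 < q" using q1 by simp
  have "of_nat q * \<delta> w = of_nat q * \<delta> \<one>"
    using constant_if_fourier_coeffs_vanish[OF fin q0 l(1,2) van w]
      constant_if_fourier_coeffs_vanish[OF fin q0 l(1,2) van one] by simp
  thus ?thesis using q1 by simp
qed

section \<open>One of the two factors of V\<close>

text \<open>The quotient of two factorizations lies in both subgroups. It is used for the
  decomposition of \<open>V\<close> and again for counting the products of \<open>W1\<close> with
  \<open>U\<close>.\<close>

lemma (in group) factorization_unique:
  assumes sub: "subgroup A G" "subgroup B G" and triv: "A \<inter> B = {\<one>}"
    and ab: "a \<in> A" "b \<in> B" "a' \<in> A" "b' \<in> B" "a \<otimes> b = a' \<otimes> b'"
  shows "a = a'" and "b = b'"
proof -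
  have c: "a \<in> carrier G" "b \<in> carrier G" "a' \<in> carrier G" "b' \<in> carrier G"
    using ab(1-4) sub by (auto dest: subgroup.subset)
  have "inv a' \<otimes> a = inv a' \<otimes> (a \<otimes> b) \<otimes> inv b" using c by (simp add: m_assoc)
  also have "\<dots> = b' \<otimes> inv b" unfolding ab(5) using c by (simp add: m_assoc[symmetric])
  finally have eq: "inv a' \<otimes> a = b' \<otimes> inv b" .
  have "inv a' \<otimes> a \<in> A" using ab sub(1) by (simp add: subgroup.m_closed subgroup.m_inv_closed)
  moreover have "inv a' \<otimes> a \<in> B"
    unfolding eq using ab sub(2) by (simp add: subgroup.m_closed subgroup.m_inv_closed)
  ultimately have "inv a' \<otimes> a = \<one>" using triv by blast
  hence "a' \<otimes> (inv a' \<otimes> a) = a'" using c by simp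
  thus "a = a'" using c by (simp add: m_assoc[symmetric])
  thus "b = b'" using ab(5) c by simp
qed

text \<open>Deliberately asymmetric: \<open>M\<close> is the kernel on \<open>V1\<close>, and
  \<open>V2\<close> is merely an invariant complement. The theorem instantiates it twice with the
  factors exchanged; \<open>M_neq\<close> records what the presence of another maximal subgroup
  implies for \<open>M\<close>.\<close>

locale extraspecial_27_factor = extraspecial_27_action E V \<alpha> + V: comm_group V
  for E :: "('e, 'c) monoid_scheme" (structure) and V :: "('v, 'd) monoid_scheme" and \<alpha> +
  fixes V1 V2 :: "'v set" and M :: "'e set"
  assumes card_V: "Coset.order V = 7 ^ 2"
    and V1: "subgroup V1 V" and V2: "subgroup V2 V" and card_V1: "card V1 = 7"
    and V1_Int_V2: "V1 \<inter> V2 = {\<one>\<^bsub>V\<^esub>}" and V1_V2: "V1 <#>\<^bsub>V\<^esub> V2 = carrier V"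
    and act_V1: "\<And>x. x \<in> carrier E \<Longrightarrow> \<alpha> x ` V1 = V1"
    and act_V2: "\<And>x. x \<in> carrier E \<Longrightarrow> \<alpha> x ` V2 = V2"
    and M_max: "maximal_subgroup M E" and M_neq: "M \<noteq> Z"
    and M_kernel: "{x \<in> carrier E. \<forall>v \<in> V1. \<alpha> x v = v} = M"
begin

lemma V1_carrier: "v \<in> V1 \<Longrightarrow> v \<in> carrier V"
  using V1 subgroup.subset by blast

lemma V2_carrier: "v \<in> V2 \<Longrightarrow> v \<in> carrier V"
  using V2 subgroup.subset by blast

lemma V1_one: "\<one>\<^bsub>V\<^esub> \<in> V1"
  using V1 by (rule subgroup.one_closed)

text \<open>The character fed to \<open>lift_representation\<close> is a faithful character of
  \<open>V1\<close> composed with the projection along \<open>V2\<close>. It is invariant under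
  \<open>M\<close> because \<open>M\<close> fixes \<open>V1\<close> pointwise and preserves
  \<open>V2\<close>.\<close>

lemma nontrivial_lift_representation:
  assumes irr: "irreducible_representation E n \<sigma>" and n: "n \<noteq> 1"
  obtains \<rho> v where "irreducible_representation G n \<rho>"
    and "\<And>v x. (v, x) \<in> pi_elements {3} G \<Longrightarrow> mtrace n (\<rho> (v, x)) = mtrace n (\<sigma> x)"
    and "v \<in> V1" and "mtrace n (\<rho> (v, \<one>)) \<noteq> of_nat n"
proof -
  interpret V1: group "V\<lparr>carrier := V1\<rparr>" using V1 by (rule V.subgroup_imp_group)
  have "Factorial_Ring.prime (7 :: nat)" by simp
  moreover have "Coset.order (V\<lparr>carrier := V1\<rparr>) = 7" using card_V1 by (simp add: Coset.order_def)
  ultimately obtain l :: "'v \<Rightarrow> complex" where l: "inj_on l V1" "\<And>v. v \<in> V1 \<Longrightarrow> l v ^ 7 = 1"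
    "\<And>v w. v \<in> V1 \<Longrightarrow> w \<in> V1 \<Longrightarrow> l (v \<otimes>\<^bsub>V\<^esub> w) = l v * l w"
    using V1.faithful_character_prime_order[of 7] by auto
  define pr where "pr = (\<lambda>v. THE a. a \<in> V1 \<and> (\<exists>b \<in> V2. v = a \<otimes>\<^bsub>V\<^esub> b))"
  have pr: "pr (a \<otimes>\<^bsub>V\<^esub> b) = a" if ab: "a \<in> V1" "b \<in> V2" for a b
    unfolding pr_def
  proof (rule the_equality)
    fix a' assume "a' \<in> V1 \<and> (\<exists>b' \<in> V2. a \<otimes>\<^bsub>V\<^esub> b = a' \<otimes>\<^bsub>V\<^esub> b')"
    then obtain b' where ab': "a' \<in> V1" "b' \<in> V2" "a \<otimes>\<^bsub>V\<^esub> b = a' \<otimes>\<^bsub>V\<^esub> b'" by blast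
    thus "a' = a" using V.factorization_unique(1)[OF V1 V2 V1_Int_V2] ab by metis
  qed (use ab in blast)
  define lam where "lam = (\<lambda>v. l (pr v))"
  have lam_ab: "lam (a \<otimes>\<^bsub>V\<^esub> b) = l a" if "a \<in> V1" "b \<in> V2" for a b
    using pr[OF that] by (simp add: lam_def)
  have split: "\<exists>a \<in> V1. \<exists>b \<in> V2. v = a \<otimes>\<^bsub>V\<^esub> b" if "v \<in> carrier V" for v
    using that unfolding V1_V2[symmetric] by (auto simp: set_mult_def)
  have lam_mult: "lam (v \<otimes>\<^bsub>V\<^esub> w) = lam v * lam w" if vw: "v \<in> carrier V" "w \<in> carrier V" for v w
  proof -
    obtain a b where ab: "a \<in> V1" "b \<in> V2" "v = a \<otimes>\<^bsub>V\<^esub> b" using split vw by blast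
    obtain a' b' where ab': "a' \<in> V1" "b' \<in> V2" "w = a' \<otimes>\<^bsub>V\<^esub> b'" using split vw by blast
    have c: "a \<in> carrier V" "b \<in> carrier V" "a' \<in> carrier V" "b' \<in> carrier V"
      using ab ab' V1_carrier V2_carrier by auto
    have "v \<otimes>\<^bsub>V\<^esub> w = (a \<otimes>\<^bsub>V\<^esub> a') \<otimes>\<^bsub>V\<^esub> (b \<otimes>\<^bsub>V\<^esub> b')"
      using c by (simp add: ab(3) ab'(3) V.m_ac)
    moreover have "a \<otimes>\<^bsub>V\<^esub> a' \<in> V1" "b \<otimes>\<^bsub>V\<^esub> b' \<in> V2"
      using ab ab' V1 V2 by (simp_all add: subgroup.m_closed)
    ultimately show ?thesis using ab ab' by (simp add: lam_ab l(3))
  qed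
  have lam7: "lam v ^ 7 = 1" if v: "v \<in> carrier V" for v
    using split[OF v] l(2) by (auto simp: lam_ab)
  have lam_inv: "lam (\<alpha> x v) = lam v" if x: "x \<in> M" and v: "v \<in> carrier V" for x v
  proof -
    obtain a b where ab: "a \<in> V1" "b \<in> V2" "v = a \<otimes>\<^bsub>V\<^esub> b" using split v by blast
    have xc: "x \<in> carrier E" and xa: "\<alpha> x a = a" using x ab(1) M_kernel by auto
    have "\<alpha> x b \<in> V2" using act_V2[OF xc] ab(2) by blast
    moreover have "\<alpha> x v = a \<otimes>\<^bsub>V\<^esub> \<alpha> x b"
      using ab xa xc V1_carrier V2_carrier by (simp add: action_mult)
    ultimately show ?thesis using ab by (simp add: lam_ab)
  qed
  obtain \<rho> where \<rho>: "irreducible_representation G n \<rho>"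
    "\<And>v x. (v, x) \<in> pi_elements {3} G \<Longrightarrow> mtrace n (\<rho> (v, x)) = mtrace n (\<sigma> x)"
    "\<And>v. v \<in> carrier V \<Longrightarrow> lam v \<noteq> 1 \<Longrightarrow> mtrace n (\<rho> (v, \<one>)) \<noteq> of_nat n"
    using lift_representation[OF irr n M_max M_neq lam_mult lam7 lam_inv] by metis
  have "V1 \<noteq> {\<one>\<^bsub>V\<^esub>}" using card_V1 by auto
  then obtain v where v: "v \<in> V1" "v \<noteq> \<one>\<^bsub>V\<^esub>" using V1_one by blast
  have "l \<one>\<^bsub>V\<^esub> = 1" using l(2)[OF V1_one] l(3)[OF V1_one V1_one] by auto
  hence "l v \<noteq> 1" using l(1) v V1_one by (metis inj_onD)
  moreover have "lam v = l v"
    using lam_ab[OF v(1) subgroup.one_closed[OF V2]] v(1) V1_carrier by simp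
  ultimately show ?thesis using that[OF \<rho>(1,2) v(1)] \<rho>(3) v(1) V1_carrier by metis
qed

section \<open>The copy of the first factor inside the semidirect product\<close>

lemma card_G: "card (carrier G) = 1323"
  using card_V card_E by (simp add: carrier_semidirect card_cartesian_product Coset.order_def)

abbreviation "W1 \<equiv> V1 \<times> {\<one>}"

lemma W1_subgroup: "subgroup W1 G"
proof -
  interpret SG: group G by (rule group_semidirect)
  show ?thesis
  proof (rule SG.subgroupI)
    fix a assume "a \<in> W1"
    then obtain v where a: "a = (v, \<one>)" "v \<in> V1" by blast
    have "inv\<^bsub>G\<^esub> a = (inv\<^bsub>V\<^esub> v, \<one>)"
      using a V1_carrier by (intro SG.inv_equality) (auto simp: semidirect_simps action_one)
    thus "inv\<^bsub>G\<^esub> a \<in> W1" using a V1 by (simp add: subgroup.m_inv_closed)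
  qed (use V1 V1_carrier V1_one in \<open>auto simp: semidirect_simps action_one subgroup.m_closed\<close>)
qed

text \<open>Conjugation by \<open>(v, x)\<close> acts on \<open>W1\<close> just as
  \<open>\<alpha> x\<close>: the component \<open>v\<close> drops out because \<open>V\<close> is
  abelian. Both normality of \<open>W1\<close> and the centralizing argument rest on this.\<close>

lemma W1_commute:
  assumes "v \<in> carrier V" "x \<in> carrier E" "w \<in> V1"
  shows "(v, x) \<otimes>\<^bsub>G\<^esub> (w, \<one>) = (\<alpha> x w, \<one>) \<otimes>\<^bsub>G\<^esub> (v, x)"
  using assms V1_carrier by (simp add: mult_semidirect action_closed action_one V.m_comm)

lemma W1_normal: "W1 \<lhd> G"
proof -
  interpret SG: group G by (rule group_semidirect)
  have "g \<otimes>\<^bsub>G\<^esub> h \<otimes>\<^bsub>G\<^esub> inv\<^bsub>G\<^esub> g \<in> W1" if g: "g \<in> carrier G" and h: "h \<in> W1" for g h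
  proof -
    obtain v x w where gh: "g = (v, x)" "h = (w, \<one>)" "v \<in> carrier V" "x \<in> carrier E" "w \<in> V1"
      using g h by (auto simp: carrier_semidirect)
    have xw: "\<alpha> x w \<in> V1" using act_V1[OF gh(4)] gh(5) by blast
    hence "(\<alpha> x w, \<one>) \<in> carrier G" using V1_carrier by (simp add: carrier_semidirect)
    hence "g \<otimes>\<^bsub>G\<^esub> h \<otimes>\<^bsub>G\<^esub> inv\<^bsub>G\<^esub> g = (\<alpha> x w, \<one>)"
      using g W1_commute[OF gh(3-5)] by (simp add: gh(1,2) SG.m_assoc)
    thus ?thesis using xw by simp
  qed
  thus ?thesis using W1_subgroup by (simp add: SG.normal_inv_iff)
qed

lemma prime_subgroup_cases:
  assumes K: "subgroup K G" "K \<subseteq> W1"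
  shows "K = {\<one>\<^bsub>G\<^esub>} \<or> K = W1"
proof -
  interpret SG: group G by (rule group_semidirect)
  have fin: "finite W1" and cW: "card W1 = 7"
    using card_V1 card_gt_0_iff[of V1] by (auto simp: card_cartesian_product)
  have "subgroup K (G\<lparr>carrier := W1\<rparr>)"
    by (rule SG.subgroup_incl[OF K(1) W1_subgroup K(2)])
  moreover have "group (G\<lparr>carrier := W1\<rparr>)" using W1_subgroup by (rule SG.subgroup_imp_group)
  ultimately have "card K dvd 7"
    using group.lagrange[of "G\<lparr>carrier := W1\<rparr>" K] cW by (metis Coset.order_def dvd_triv_right partial_object.select_convs(1) partial_object.surjective partial_object.update_convs(1))
  moreover have "Factorial_Ring.prime (7 :: nat)" by simp
  ultimately have "card K = 1 \<or> card K = 7" by (auto simp: prime_nat_iff)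
  thus ?thesis
  proof
    assume "card K = 1"
    thus ?thesis using subgroup.one_closed[OF K(1)] by (auto simp: card_1_singleton_iff)
  next
    assume "card K = 7"
    thus ?thesis using card_subset_eq[OF fin K(2)] cW by simp
  qed
qed

text \<open>Since \<open>W1\<close> has prime order, failure means trivial intersection with
  \<open>U\<close>. Products of \<open>W1\<close> and \<open>U\<close> are then distinct, giving
  \<open>7 * card U \<le> card (carrier G)\<close>, against index at most 3.\<close>

lemma subgroup_index_le_3:
  assumes U: "subgroup U G" and le: "card (carrier G) \<le> 3 * card U"
  shows "W1 \<subseteq> U"
proof (rule ccontr)
  interpret SG: group G by (rule group_semidirect)
  assume "\<not> W1 \<subseteq> U"
  moreover have "subgroup (W1 \<inter> U) G" by (rule SG.subgroups_Inter_pair[OF W1_subgroup U])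
  ultimately have triv: "W1 \<inter> U = {\<one>\<^bsub>G\<^esub>}" using prime_subgroup_cases[of "W1 \<inter> U"] by blast
  have sub: "W1 \<subseteq> carrier G" "U \<subseteq> carrier G" using W1_subgroup U by (auto dest: subgroup.subset)
  have fin: "finite (carrier G)" using card_G card_gt_0_iff[of "carrier G"] by simp
  have "inj_on (\<lambda>(w, u). w \<otimes>\<^bsub>G\<^esub> u) (W1 \<times> U)"
  proof (rule inj_onI)
    fix p q assume p: "p \<in> W1 \<times> U" and q: "q \<in> W1 \<times> U"
      and eq: "(\<lambda>(w, u). w \<otimes>\<^bsub>G\<^esub> u) p = (\<lambda>(w, u). w \<otimes>\<^bsub>G\<^esub> u) q"
    have pq: "fst p \<in> W1" "snd p \<in> U" "fst q \<in> W1" "snd q \<in> U"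
      using p q by (simp_all only: mem_Times_iff)
    have eq': "fst p \<otimes>\<^bsub>G\<^esub> snd p = fst q \<otimes>\<^bsub>G\<^esub> snd q" using eq by (simp only: case_prod_beta)
    show "p = q"
      using SG.factorization_unique[OF W1_subgroup U triv pq eq'] by (rule prod_eqI)
  qed
  moreover have "(\<lambda>(w, u). w \<otimes>\<^bsub>G\<^esub> u) ` (W1 \<times> U) \<subseteq> carrier G"
  proof (rule image_subsetI)
    fix p assume "p \<in> W1 \<times> U"
    hence "fst p \<in> carrier G" "snd p \<in> carrier G" using sub by (auto simp only: mem_Times_iff)
    thus "(\<lambda>(w, u). w \<otimes>\<^bsub>G\<^esub> u) p \<in> carrier G" by (simp only: case_prod_beta SG.m_closed)
  qed
  ultimately have "card (W1 \<times> U) \<le> card (carrier G)" using fin by (metis card_inj_on_le)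
  hence "7 * card U \<le> 1323" using card_V1 card_G by (simp add: card_cartesian_product)
  thus False using le card_G by simp
qed

text \<open>A character \<open>(\<delta>\<gamma>)\<^sup>G\<close> of degree 3 that is nontrivial on \<open>V1\<close> forces \<open>\<gamma>\<close> to be nontrivial, hence
  faithful, on \<open>V1\<close>; as \<open>\<gamma>\<close> is invariant under \<open>U\<close>, the group \<open>U\<close> then centralizes \<open>V1\<close>.\<close>

lemma induced_nontrivial_imp_centralizes:
  assumes U: "subgroup U G" and sp: "pi_special {3} (G\<lparr>carrier := U\<rparr>) \<delta>"
    and \<gamma>: "\<gamma> \<in> Irr (G\<lparr>carrier := U\<rparr>)" "\<gamma> \<one>\<^bsub>G\<^esub> = 1"
    and deg: "induced_char G U (\<lambda>u \<in> U. \<delta> u * \<gamma> u) \<one>\<^bsub>G\<^esub> = 3"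
    and v: "v \<in> V1" "induced_char G U (\<lambda>u \<in> U. \<delta> u * \<gamma> u) (v, \<one>) \<noteq> 3"
  shows "snd ` U \<subseteq> M" and "card (carrier G) \<le> 3 * card U"
proof -
  interpret SG: group G by (rule group_semidirect)
  interpret UG: group "G\<lparr>carrier := U\<rparr>" using U by (rule SG.subgroup_imp_group)
  let ?\<theta> = "\<lambda>u \<in> U. \<delta> u * \<gamma> u"
  have sub: "U \<subseteq> carrier G" using U by (rule subgroup.subset)
  have fin: "finite (carrier G)" using card_G card_gt_0_iff[of "carrier G"] by simp
  have oneU: "\<one>\<^bsub>G\<^esub> \<in> U" using U by (rule subgroup.one_closed)
  have cU: "card U > 0" using oneU finite_subset[OF sub fin] card_gt_0_iff by blast
  \<comment> \<open>If all conjugates of \<open>g\<close> carry the same value, the induction sum is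
    constant. This is applied at the identity and, under the assumption refuted below, at
    \<open>(v, \<one>)\<close>.\<close>
  have ind: "induced_char G U ?\<theta> g = of_nat (card (carrier G)) * \<delta> \<one>\<^bsub>G\<^esub> / of_nat (card U)"
    if g: "g \<in> carrier G" and c: "\<And>x. x \<in> carrier G \<Longrightarrow>
        x \<otimes>\<^bsub>G\<^esub> g \<otimes>\<^bsub>G\<^esub> inv\<^bsub>G\<^esub> x \<in> U \<and> ?\<theta> (x \<otimes>\<^bsub>G\<^esub> g \<otimes>\<^bsub>G\<^esub> inv\<^bsub>G\<^esub> x) = \<delta> \<one>\<^bsub>G\<^esub>" for g
  proof -
    have "(\<Sum>x \<in> carrier G. if x \<otimes>\<^bsub>G\<^esub> g \<otimes>\<^bsub>G\<^esub> inv\<^bsub>G\<^esub> x \<in> U then ?\<theta> (x \<otimes>\<^bsub>G\<^esub> g \<otimes>\<^bsub>G\<^esub> inv\<^bsub>G\<^esub> x) else 0)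
        = (\<Sum>x \<in> carrier G. \<delta> \<one>\<^bsub>G\<^esub>)"
      using c by (intro sum.cong) (auto simp del: restrict_apply)
    thus ?thesis using g by (simp add: induced_char_def)
  qed
  have ind1: "induced_char G U ?\<theta> \<one>\<^bsub>G\<^esub> = of_nat (card (carrier G)) * \<delta> \<one>\<^bsub>G\<^esub> / of_nat (card U)"
    by (rule ind) (use oneU \<gamma>(2) in auto)
  obtain n where n: "\<delta> \<one>\<^bsub>G\<^esub> = of_nat n" "0 < n" using sp by (auto simp: pi_special_def pi_number_def)
  have "of_nat (card (carrier G) * n) = (of_nat (3 * card U) :: complex)"
    using deg unfolding ind1 n(1) using cU by (simp add: field_simps)
  hence "card (carrier G) * n = 3 * card U" by (simp only: of_nat_eq_iff)
  \<comment> \<open>The degree of \<open>\<delta>\<close> is a positive integer, so the degree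
    equation becomes a bound on the index.\<close>
  moreover have "card (carrier G) * 1 \<le> card (carrier G) * n" using n(2) by (intro mult_le_mono2) simp
  ultimately show le: "card (carrier G) \<le> 3 * card U" by simp
  have W1U: "W1 \<subseteq> U" by (rule subgroup_index_le_3[OF U le])
  have WU: "W1 \<lhd> G\<lparr>carrier := U\<rparr>" using U W1_normal W1U by (rule SG.normal_restrict_supergroup)
  have \<delta>1: "\<delta> w = \<delta> \<one>\<^bsub>G\<^esub>" if "w \<in> W1" for w
    using UG.pi_special_constant_on_normal_prime_subgroup[of 7 3 W1 \<delta> w] WU sp that card_V1
    by (simp add: card_cartesian_product)
  have \<gamma>_mult: "\<gamma> (a \<otimes>\<^bsub>G\<^esub> b) = \<gamma> a * \<gamma> b" if "a \<in> U" "b \<in> U" for a b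
    using linear_Irr_mult[of \<gamma> "G\<lparr>carrier := U\<rparr>" a b] \<gamma> oneU that U by (simp add: subgroup.m_closed)
  have \<gamma>_nz: "\<gamma> a \<noteq> 0" if "a \<in> U" for a
  proof
    assume "\<gamma> a = 0"
    hence "\<gamma> (a \<otimes>\<^bsub>G\<^esub> inv\<^bsub>G\<^esub> a) = 0" using \<gamma>_mult that U by (simp add: subgroup.m_inv_closed)
    thus False using that sub \<gamma>(2) by (simp add: subsetD)
  qed
  define K where "K = {w \<in> W1. \<gamma> w = 1}"
  have K: "subgroup K G"
  proof (rule SG.subgroupI)
    fix a assume a: "a \<in> K"
    hence aU: "a \<in> U" "inv\<^bsub>G\<^esub> a \<in> U" "\<gamma> a = 1" using W1U U by (auto simp: K_def subgroup.m_inv_closed)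
    have "\<gamma> a * \<gamma> (inv\<^bsub>G\<^esub> a) = 1" using \<gamma>_mult[OF aU(1,2)] aU(1) sub \<gamma>(2) by (simp add: subsetD)
    thus "inv\<^bsub>G\<^esub> a \<in> K" using a aU(3) subgroup.m_inv_closed[OF W1_subgroup] by (simp add: K_def)
  next
    fix a b assume ab: "a \<in> K" "b \<in> K"
    hence "a \<in> U" "b \<in> U" using W1U by (auto simp: K_def)
    thus "a \<otimes>\<^bsub>G\<^esub> b \<in> K"
      using ab subgroup.m_closed[OF W1_subgroup] by (simp add: K_def \<gamma>_mult)
  next
    show "K \<subseteq> carrier G" using W1U sub by (auto simp: K_def)
    show "K \<noteq> {}" using subgroup.one_closed[OF W1_subgroup] \<gamma>(2) by (auto simp: K_def)
  qed
  \<comment> \<open>Otherwise \<open>\<delta>\<gamma>\<close> is constant on the normal subgroup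
    \<open>W1\<close>, and the induced character takes at \<open>(v, \<one>)\<close> the same value
    3 as at the identity, contrary to the choice of \<open>v\<close>.\<close>
  have "K \<noteq> W1"
  proof
    assume KW: "K = W1"
    have vW: "(v, \<one>) \<in> W1" using v by simp
    have "induced_char G U ?\<theta> (v, \<one>) = of_nat (card (carrier G)) * \<delta> \<one>\<^bsub>G\<^esub> / of_nat (card U)"
    proof (rule ind)
      show "(v, \<one>) \<in> carrier G" using vW W1U sub by blast
      fix x assume x: "x \<in> carrier G"
      have "x \<otimes>\<^bsub>G\<^esub> (v, \<one>) \<otimes>\<^bsub>G\<^esub> inv\<^bsub>G\<^esub> x \<in> W1"
        using W1_normal x vW by (simp add: SG.normal_inv_iff)
      moreover from this have "\<gamma> (x \<otimes>\<^bsub>G\<^esub> (v, \<one>) \<otimes>\<^bsub>G\<^esub> inv\<^bsub>G\<^esub> x) = 1" using KW by (auto simp: K_def)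
      ultimately show "x \<otimes>\<^bsub>G\<^esub> (v, \<one>) \<otimes>\<^bsub>G\<^esub> inv\<^bsub>G\<^esub> x \<in> U \<and>
          ?\<theta> (x \<otimes>\<^bsub>G\<^esub> (v, \<one>) \<otimes>\<^bsub>G\<^esub> inv\<^bsub>G\<^esub> x) = \<delta> \<one>\<^bsub>G\<^esub>"
        using W1U \<delta>1 by (metis (no_types, lifting) mult.right_neutral restrict_apply' subsetD)
    qed
    thus False using ind1 deg v(2) by simp
  qed
  hence K1: "K = {\<one>\<^bsub>G\<^esub>}" using prime_subgroup_cases[OF K] by (auto simp: K_def)
  have \<gamma>_inj: "a = b" if ab: "a \<in> W1" "b \<in> W1" "\<gamma> a = \<gamma> b" for a b
  proof -
    have U2: "a \<in> U" "b \<in> U" "inv\<^bsub>G\<^esub> b \<in> U" using ab W1U U by (auto simp: subgroup.m_inv_closed)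
    have c: "a \<in> carrier G" "b \<in> carrier G" using U2 sub by auto
    have "\<gamma> (a \<otimes>\<^bsub>G\<^esub> inv\<^bsub>G\<^esub> b) = \<gamma> (b \<otimes>\<^bsub>G\<^esub> inv\<^bsub>G\<^esub> b)" using \<gamma>_mult U2 ab(3) by simp
    also have "\<dots> = 1" using c \<gamma>(2) by simp
    finally have "a \<otimes>\<^bsub>G\<^esub> inv\<^bsub>G\<^esub> b \<in> K"
      using ab W1_subgroup by (simp add: K_def subgroup.m_closed subgroup.m_inv_closed del: mem_Sigma_iff)
    hence "a \<otimes>\<^bsub>G\<^esub> inv\<^bsub>G\<^esub> b = \<one>\<^bsub>G\<^esub>" using K1 by blast
    thus ?thesis using c by (metis SG.inv_closed SG.inv_equality SG.inv_inv)
  qed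
  show "snd ` U \<subseteq> M"
  proof
    fix x assume "x \<in> snd ` U"
    then obtain u where u: "(u, x) \<in> U" by force
    hence ux: "u \<in> carrier V" "x \<in> carrier E" using sub by (auto simp: carrier_semidirect)
    have "\<alpha> x w = w" if w: "w \<in> V1" for w
    proof -
      have xw: "\<alpha> x w \<in> V1" using act_V1[OF ux(2)] w by blast
      hence U2: "(w, \<one>) \<in> U" "(\<alpha> x w, \<one>) \<in> U" using w W1U by auto
      \<comment> \<open>Values of \<open>\<gamma>\<close> commute and are nonzero, so
        \<open>(w, \<one>)\<close> and its conjugate have the same value; injectivity on
        \<open>W1\<close> then identifies them.\<close>
      have "\<gamma> (u, x) * \<gamma> (w, \<one>) = \<gamma> (\<alpha> x w, \<one>) * \<gamma> (u, x)"
        using \<gamma>_mult[OF u U2(1)] \<gamma>_mult[OF U2(2) u] W1_commute[OF ux w] by auto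
      hence "\<gamma> (w, \<one>) = \<gamma> (\<alpha> x w, \<one>)" using \<gamma>_nz[OF u] by simp
      hence "(w, \<one>) = (\<alpha> x w, \<one>)" using w xw by (intro \<gamma>_inj) auto
      thus ?thesis by simp
    qed
    thus "x \<in> M" using ux(2) M_kernel by blast
  qed
qed

end

section \<open>The counterexample\<close>

context semidirect
begin

lemma normal_V: "carrier V \<times> {\<one>\<^bsub>E\<^esub>} \<lhd> G"
proof -
  have "group_hom G E snd"
    using group_semidirect E.is_group
    by (auto simp: group_hom_def group_hom_axioms_def hom_def semidirect_simps)
  hence "kernel G E snd \<lhd> G" by (rule group_hom.normal_kernel)
  moreover have "kernel G E snd = carrier V \<times> {\<one>\<^bsub>E\<^esub>}"
    by (auto simp: kernel_def carrier_semidirect)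
  ultimately show ?thesis by simp
qed

lemma coset_of_V:
  assumes "v \<in> carrier V" "x \<in> carrier E"
  shows "carrier V \<times> {\<one>\<^bsub>E\<^esub>} #>\<^bsub>G\<^esub> (v, x) = carrier V \<times> {x}"
proof -
  have "\<exists>w \<in> carrier V. u = w \<otimes>\<^bsub>V\<^esub> v" if "u \<in> carrier V" for u
    using assms that by (intro bexI[of _ "u \<otimes>\<^bsub>V\<^esub> inv\<^bsub>V\<^esub> v"]) (auto simp: V.m_assoc)
  thus ?thesis using assms by (auto simp: r_coset_def mult_semidirect action_one image_iff)
qed

text \<open>The map sending \<open>x\<close> to the coset \<open>carrier V \<times> {x}\<close>
  identifies \<open>E\<close> with the quotient; composing the representation with it keeps the
  space and its invariant subspaces.\<close>

lemma Irr_quotient_restricts: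
  assumes "\<chi> \<in> Irr (G Mod (carrier V \<times> {\<one>\<^bsub>E\<^esub>}))"
  obtains n \<sigma> where "irreducible_representation E n \<sigma>"
    and "\<And>v x. v \<in> carrier V \<Longrightarrow> x \<in> carrier E \<Longrightarrow>
      inflate_char G (carrier V \<times> {\<one>\<^bsub>E\<^esub>}) \<chi> (v, x) = mtrace n (\<sigma> x)"
proof -
  let ?N = "carrier V \<times> {\<one>\<^bsub>E\<^esub>}"
  let ?Q = "G Mod ?N"
  obtain n \<rho> where irr: "irreducible_representation ?Q n \<rho>" and \<chi>: "\<chi> = character_of ?Q n \<rho>"
    using assms by (auto simp: Irr_def)
  have rep: "representation ?Q n \<rho>" and n: "0 < n"
    using irr by (auto simp: irreducible_representation_def)
  have carrQ: "carrier ?Q = (\<lambda>x. carrier V \<times> {x}) ` carrier E"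
  proof -
    have "carrier ?Q = (\<lambda>g. ?N #>\<^bsub>G\<^esub> g) ` carrier G" by (auto simp: FactGroup_def RCOSETS_def)
    also have "\<dots> = (\<lambda>g. carrier V \<times> {snd g}) ` (carrier V \<times> carrier E)"
      by (intro image_cong) (auto simp: carrier_semidirect coset_of_V)
    also have "\<dots> = (\<lambda>x. carrier V \<times> {x}) ` snd ` (carrier V \<times> carrier E)"
      by (simp only: image_image)
    also have "snd ` (carrier V \<times> carrier E) = carrier E"
      using V.one_closed by force
    finally show ?thesis .
  qed
  have multQ: "(carrier V \<times> {x}) \<otimes>\<^bsub>?Q\<^esub> (carrier V \<times> {y}) = carrier V \<times> {x \<otimes>\<^bsub>E\<^esub> y}"
    if "x \<in> carrier E" "y \<in> carrier E" for x y
    using normal.rcos_sum[OF normal_V, of "(\<one>\<^bsub>V\<^esub>, x)" "(\<one>\<^bsub>V\<^esub>, y)"] that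
    by (simp add: coset_of_V semidirect_simps action_by_one FactGroup_def)
  define \<sigma> where "\<sigma> = (\<lambda>x. \<rho> (carrier V \<times> {x}))"
  have "representation E n \<sigma>"
    unfolding representation_def
  proof (intro conjI ballI)
    show "\<sigma> \<in> carrier E \<rightarrow> carrier_mat n n"
      using rep by (auto simp: \<sigma>_def representation_def carrQ)
    show "\<sigma> \<one>\<^bsub>E\<^esub> = 1\<^sub>m n"
      using rep by (simp add: \<sigma>_def representation_def FactGroup_def)
    show "\<sigma> (x \<otimes>\<^bsub>E\<^esub> y) = \<sigma> x * \<sigma> y" if "x \<in> carrier E" "y \<in> carrier E" for x y
      using rep that by (simp add: \<sigma>_def representation_def carrQ multQ[symmetric])
  qed
  moreover have "W = {0\<^sub>v n} \<or> W = carrier_vec n"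
    if "subspace class_ring W (module_vec TYPE(complex) n)"
      "\<forall>x \<in> carrier E. \<forall>w \<in> W. \<sigma> x *\<^sub>v w \<in> W" for W
    using irr that unfolding irreducible_representation_def by (auto simp: \<sigma>_def carrQ)
  ultimately have "irreducible_representation E n \<sigma>"
    using n by (auto simp: irreducible_representation_def)
  moreover have "inflate_char G ?N \<chi> (v, x) = mtrace n (\<sigma> x)"
    if "v \<in> carrier V" "x \<in> carrier E" for v x
    using that by (simp add: inflate_char_def carrier_semidirect coset_of_V \<chi> character_of_def
        carrQ \<sigma>_def mtrace_def)
  ultimately show ?thesis by (rule that)
qed

end

text \<open>Distinct maximal subgroups do not contain one another, so the intersection is a proper
  subgroup of a group of order 9.\<close>

lemma (in extraspecial_27) card_Int_maximal_le:
  assumes M1: "maximal_subgroup M1 E" and M2: "maximal_subgroup M2 E" and neq: "M1 \<noteq> M2"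
  shows "card (M1 \<inter> M2) \<le> 3"
proof -
  have sub: "subgroup M1 E" "subgroup M2 E" "M1 \<noteq> carrier E" "M2 \<noteq> carrier E"
    using M1 M2 by (auto simp: maximal_subgroup_def)
  have "Z \<subset> M1" using center_subset_maximal[OF M1] maximal_neq_center[OF M1 M2 neq] by auto
  hence c9: "card M1 = 9" using sub by (intro card_subgroup_above_center) auto
  have "M1 \<inter> M2 \<noteq> M1"
  proof
    assume "M1 \<inter> M2 = M1"
    hence "M1 \<subseteq> M2" by blast
    thus False using M1 sub neq by (auto simp: maximal_subgroup_def)
  qed
  moreover have "finite M1" using c9 card_gt_0_iff[of M1] by simp
  ultimately have "card (M1 \<inter> M2) < 9" using c9 psubset_card_mono[of M1 "M1 \<inter> M2"] by auto
  moreover have "subgroup (M1 \<inter> M2) E" using sub by (intro subgroups_Inter_pair)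
  ultimately show ?thesis using card_subgroup_cases by force
qed

theorem mainTheorem3:
  fixes E :: "('e, 'c) monoid_scheme" and V :: "('v, 'd) monoid_scheme"
    and V1 V2 :: "'v set" and M1 M2 :: "'e set"
    and \<alpha> :: "'e \<Rightarrow> 'v \<Rightarrow> 'v"
    and G :: "('v \<times> 'e) monoid" and N :: "('v \<times> 'e) set"
    and \<pi> :: "nat set"
    and \<chi>' :: "('v \<times> 'e) set \<Rightarrow> complex"
    and \<chi> \<phi> :: "'v \<times> 'e \<Rightarrow> complex"
  assumes "extraspecial 3 E" and "Coset.order E = 3 ^ 3" and "group_exponent E = 3"
    and "elementary_abelian 7 V" and "Coset.order V = 7 ^ 2"
    and "subgroup V1 V" and "subgroup V2 V" and "card V1 = 7" and "card V2 = 7"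
    and "V1 \<inter> V2 = {\<one>\<^bsub>V\<^esub>}" and "V1 <#>\<^bsub>V\<^esub> V2 = carrier V"
    and "maximal_subgroup M1 E" and "maximal_subgroup M2 E" and "M1 \<noteq> M2"
    and "\<alpha> \<in> hom E (AutoGroup V)"
    and "\<forall>e \<in> carrier E. \<alpha> e ` V1 = V1" and "\<forall>e \<in> carrier E. \<alpha> e ` V2 = V2"
    and "{e \<in> carrier E. \<forall>v \<in> V1. \<alpha> e v = v} = M1"
    and "{e \<in> carrier E. \<forall>v \<in> V2. \<alpha> e v = v} = M2"
    and "G = semidirect_product V E \<alpha>" and "N = carrier V \<times> {\<one>\<^bsub>E\<^esub>}"
    and "\<pi> = {3}"
    and "\<chi>' \<in> Irr (G Mod N)" and "\<chi> = inflate_char G N \<chi>'" and "\<chi> \<one>\<^bsub>G\<^esub> = 3"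
    and "\<phi> = restrict \<chi> (pi_elements \<pi> G)"
  shows "\<not> (\<exists>U \<delta>. subgroup U G \<and> pi_special \<pi> (G\<lparr>carrier := U\<rparr>) \<delta> \<and>
           bij_betw (\<lambda>\<gamma>. induced_char G U (\<lambda>u \<in> U. \<delta> u * \<gamma> u))
             {\<gamma>. pi_special (- \<pi>) (G\<lparr>carrier := U\<rparr>) \<gamma> \<and> \<gamma> \<one>\<^bsub>G\<^esub> = 1}
             (lifts \<pi> G \<phi>))"
proof
  have E: "group E" using assms(1) by (simp add: extraspecial_def)
  have V: "comm_group V" using assms(4) by (simp add: elementary_abelian_def)
  interpret V: comm_group V by (rule V)
  have V21: "V2 <#>\<^bsub>V\<^esub> V1 = carrier V"
  proof -
    have "v \<in> V2 <#>\<^bsub>V\<^esub> V1 \<longleftrightarrow> v \<in> V1 <#>\<^bsub>V\<^esub> V2" for v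
      unfolding set_mult_def using V.m_comm subgroup.subset[OF assms(6)] subgroup.subset[OF assms(7)]
      by (simp add: subset_iff) metis
    thus ?thesis using assms(11) by blast
  qed
  interpret E27: extraspecial_27 E
    using E assms(1-3) by (simp add: extraspecial_27_def extraspecial_27_axioms_def)
  have MZ: "M1 \<noteq> E27.Z" "M2 \<noteq> E27.Z"
    using E27.maximal_neq_center assms(12-14) by metis+
  have act: "extraspecial_27_action E V \<alpha>"
    by (intro extraspecial_27_action.intro semidirect.intro semidirect_axioms.intro
        E27.extraspecial_27_axioms E V.is_group assms(15))
  interpret F1: extraspecial_27_factor E V \<alpha> V1 V2 M1
    by (intro extraspecial_27_factor.intro extraspecial_27_factor_axioms.intro act V
        assms(5-8,10-12,18) MZ(1) bspec[OF assms(16)] bspec[OF assms(17)])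
  have V2_Int_V1: "V2 \<inter> V1 = {\<one>\<^bsub>V\<^esub>}" using assms(10) by blast
  interpret F2: extraspecial_27_factor E V \<alpha> V2 V1 M2
    by (intro extraspecial_27_factor.intro extraspecial_27_factor_axioms.intro act V
        assms(5-7,9,13,19) MZ(2) V21 V2_Int_V1 bspec[OF assms(16)] bspec[OF assms(17)])
  note G = assms(20) and N = assms(21) and pi = assms(22)
  obtain n \<sigma> where irr: "irreducible_representation E n \<sigma>"
    and ch: "\<And>v x. v \<in> carrier V \<Longrightarrow> x \<in> carrier E \<Longrightarrow> \<chi> (v, x) = mtrace n (\<sigma> x)"
    using F1.Irr_quotient_restricts assms(23) unfolding assms(24) G N by metis
  have "\<chi> (\<one>\<^bsub>V\<^esub>, \<one>\<^bsub>E\<^esub>) = of_nat n"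
    using irr by (simp add: ch irreducible_representation_def representation_def mtrace_one)
  hence "of_nat n = (3 :: complex)" using assms(25) by (simp add: G F1.one_semidirect)
  hence n: "n = 3" by (metis of_nat_eq_iff of_nat_numeral)

  \<comment> \<open>The identity is a 3-element, so every lift has the degree 3 of
    \<open>\<chi>\<close>.\<close>
  have one_pi: "\<one>\<^bsub>G\<^esub> \<in> pi_elements \<pi> G"
    using group.ord_id[OF F1.group_semidirect] monoid.one_closed[OF group.is_monoid[OF F1.group_semidirect]]
    by (simp add: pi_elements_def pi_number_def G)
  have lift_one: "\<psi> \<one>\<^bsub>G\<^esub> = 3" if "\<psi> \<in> lifts \<pi> G \<phi>" for \<psi>
  proof -
    have "restrict \<psi> (pi_elements \<pi> G) \<one>\<^bsub>G\<^esub> = \<phi> \<one>\<^bsub>G\<^esub>" using that by (simp add: lifts_def)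
    thus ?thesis using one_pi assms(25,26) by simp
  qed
  have lift_char: "character_of G n \<rho> \<in> lifts \<pi> G \<phi>"
    if "irreducible_representation G n \<rho>"
      "\<And>v x. (v, x) \<in> pi_elements {3} G \<Longrightarrow> mtrace n (\<rho> (v, x)) = mtrace n (\<sigma> x)" for \<rho>
  proof -
    have "character_of G n \<rho> \<in> Irr G" using that(1) by (auto simp: Irr_def)
    moreover have "character_of G n \<rho> g = \<chi> g" if g: "g \<in> pi_elements \<pi> G" for g
    proof -
      obtain v x where gvx: "g = (v, x)" by (cases g)
      have c: "g \<in> carrier G" using g by (simp add: pi_elements_def)
      hence "v \<in> carrier V" "x \<in> carrier E" by (auto simp: gvx G F1.carrier_semidirect)
      hence "\<chi> g = mtrace n (\<sigma> x)" by (simp add: gvx ch)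
      also have "\<dots> = mtrace n (\<rho> g)"
        using \<open>\<And>v x. (v, x) \<in> pi_elements {3} G \<Longrightarrow> mtrace n (\<rho> (v, x)) = mtrace n (\<sigma> x)\<close> g
        by (simp add: gvx pi)
      finally show ?thesis using c by (simp add: character_of_def mtrace_def)
    qed
    moreover from this have "restrict (character_of G n \<rho>) (pi_elements \<pi> G) = \<phi>"
      unfolding assms(26) by (rule restrict_ext)
    ultimately show ?thesis by (simp add: lifts_def)
  qed
  have char_at: "character_of G n \<rho> (v, \<one>\<^bsub>E\<^esub>) = mtrace n (\<rho> (v, \<one>\<^bsub>E\<^esub>))" if "v \<in> carrier V" for \<rho> v
    using that by (simp add: character_of_def mtrace_def G F1.carrier_semidirect)
  have n1: "n \<noteq> 1" using n by simp
  obtain \<psi>1 v1 where \<psi>1: "\<psi>1 \<in> lifts \<pi> G \<phi>" "v1 \<in> V1" "\<psi>1 (v1, \<one>\<^bsub>E\<^esub>) \<noteq> 3"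
  proof (rule F1.nontrivial_lift_representation[OF irr n1])
    fix \<rho> v
    assume \<rho>: "irreducible_representation (semidirect_product V E \<alpha>) n \<rho>"
        "\<And>v x. (v, x) \<in> pi_elements {3} (semidirect_product V E \<alpha>) \<Longrightarrow> mtrace n (\<rho> (v, x)) = mtrace n (\<sigma> x)"
      and v: "v \<in> V1" "mtrace n (\<rho> (v, \<one>\<^bsub>E\<^esub>)) \<noteq> of_nat n"
    have "character_of G n \<rho> \<in> lifts \<pi> G \<phi>" using \<rho> by (intro lift_char) (auto simp: G)
    moreover have "character_of G n \<rho> (v, \<one>\<^bsub>E\<^esub>) \<noteq> 3"
      using v(2) n unfolding char_at[OF F1.V1_carrier[OF v(1)]] by simp
    ultimately show thesis using that v(1) by blast
  qed
  obtain \<psi>2 v2 where \<psi>2: "\<psi>2 \<in> lifts \<pi> G \<phi>" "v2 \<in> V2" "\<psi>2 (v2, \<one>\<^bsub>E\<^esub>) \<noteq> 3"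
  proof (rule F2.nontrivial_lift_representation[OF irr n1])
    fix \<rho> v
    assume \<rho>: "irreducible_representation (semidirect_product V E \<alpha>) n \<rho>"
        "\<And>v x. (v, x) \<in> pi_elements {3} (semidirect_product V E \<alpha>) \<Longrightarrow> mtrace n (\<rho> (v, x)) = mtrace n (\<sigma> x)"
      and v: "v \<in> V2" "mtrace n (\<rho> (v, \<one>\<^bsub>E\<^esub>)) \<noteq> of_nat n"
    have "character_of G n \<rho> \<in> lifts \<pi> G \<phi>" using \<rho> by (intro lift_char) (auto simp: G)
    moreover have "character_of G n \<rho> (v, \<one>\<^bsub>E\<^esub>) \<noteq> 3"
      using v(2) n unfolding char_at[OF F2.V1_carrier[OF v(1)]] by simp
    ultimately show thesis using that v(1) by blast
  qed

  assume "\<exists>U \<delta>. subgroup U G \<and> pi_special \<pi> (G\<lparr>carrier := U\<rparr>) \<delta> \<and>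
           bij_betw (\<lambda>\<gamma>. induced_char G U (\<lambda>u \<in> U. \<delta> u * \<gamma> u))
             {\<gamma>. pi_special (- \<pi>) (G\<lparr>carrier := U\<rparr>) \<gamma> \<and> \<gamma> \<one>\<^bsub>G\<^esub> = 1}
             (lifts \<pi> G \<phi>)"
  then obtain U \<delta> where U: "subgroup U G" and sp: "pi_special \<pi> (G\<lparr>carrier := U\<rparr>) \<delta>"
    and bij: "bij_betw (\<lambda>\<gamma>. induced_char G U (\<lambda>u \<in> U. \<delta> u * \<gamma> u))
             {\<gamma>. pi_special (- \<pi>) (G\<lparr>carrier := U\<rparr>) \<gamma> \<and> \<gamma> \<one>\<^bsub>G\<^esub> = 1} (lifts \<pi> G \<phi>)"
    by blast
  have surj: "\<exists>\<gamma>. \<gamma> \<in> Irr (G\<lparr>carrier := U\<rparr>) \<and> \<gamma> \<one>\<^bsub>G\<^esub> = 1 \<and>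
      \<psi> = induced_char G U (\<lambda>u \<in> U. \<delta> u * \<gamma> u)" if "\<psi> \<in> lifts \<pi> G \<phi>" for \<psi>
  proof -
    have "\<psi> \<in> (\<lambda>\<gamma>. induced_char G U (\<lambda>u \<in> U. \<delta> u * \<gamma> u)) `
        {\<gamma>. pi_special (- \<pi>) (G\<lparr>carrier := U\<rparr>) \<gamma> \<and> \<gamma> \<one>\<^bsub>G\<^esub> = 1}"
      using bij that by (simp add: bij_betw_def)
    thus ?thesis by (auto simp: pi_special_def)
  qed
  obtain \<gamma>1 where \<gamma>1: "\<gamma>1 \<in> Irr (G\<lparr>carrier := U\<rparr>)" "\<gamma>1 \<one>\<^bsub>G\<^esub> = 1"
    "\<psi>1 = induced_char G U (\<lambda>u \<in> U. \<delta> u * \<gamma>1 u)" using surj[OF \<psi>1(1)] by blast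
  obtain \<gamma>2 where \<gamma>2: "\<gamma>2 \<in> Irr (G\<lparr>carrier := U\<rparr>)" "\<gamma>2 \<one>\<^bsub>G\<^esub> = 1"
    "\<psi>2 = induced_char G U (\<lambda>u \<in> U. \<delta> u * \<gamma>2 u)" using surj[OF \<psi>2(1)] by blast
  have U1: "snd ` U \<subseteq> M1" and le: "card (carrier G) \<le> 3 * card U"
    using F1.induced_nontrivial_imp_centralizes[of U \<delta> \<gamma>1 v1] U sp \<gamma>1(1,2) \<psi>1(2,3) lift_one[OF \<psi>1(1)]
    unfolding \<gamma>1(3) G pi by blast+
  have U2: "snd ` U \<subseteq> M2"
    using F2.induced_nontrivial_imp_centralizes(1)[of U \<delta> \<gamma>2 v2] U sp \<gamma>2(1,2) \<psi>2(2,3) lift_one[OF \<psi>2(1)]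
    unfolding \<gamma>2(3) G pi by blast
  \<comment> \<open>This caps \<open>card U\<close> at \<open>49 * 3 = 147\<close>, whereas
    \<open>le\<close> together with \<open>card (carrier G) = 1323\<close> requires at least
    441.\<close>
  have "U \<subseteq> carrier V \<times> (M1 \<inter> M2)"
  proof
    fix u assume u: "u \<in> U"
    have "u \<in> carrier G" using u U subgroup.subset by blast
    thus "u \<in> carrier V \<times> (M1 \<inter> M2)"
      using u U1 U2 by (auto simp: G F1.carrier_semidirect mem_Times_iff)
  qed
  moreover have "finite (carrier V)" using assms(5) V.order_gt_0_iff_finite by force
  moreover have "finite (M1 \<inter> M2)"
    using E27.fin assms(12) by (meson finite_Int finite_subset maximal_subgroup_def subgroup.subset)
  ultimately have "card U \<le> card (carrier V) * card (M1 \<inter> M2)"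
    by (metis card_cartesian_product card_mono finite_cartesian_product)
  also have "\<dots> \<le> 49 * 3"
    using assms(5) E27.card_Int_maximal_le[OF assms(12-14)] by (simp add: Coset.order_def)
  finally show False using le F1.card_G by (simp add: G)
qed

end
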